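(* If $S$ and $T$ are dual equivalent standard skew tableaux (of the same skew shape, whose row lengths weakly decrease from top to bottom), then $\operatorname{stab}(S)=\operatorname{stab}(T)$.
   Context: The reading word of a skew tableau reads each row left to right, from the bottom row to the top row. For an integer $i$, the elementary dual equivalence move $d_i$ on a standard skew tableau swaps the entries $i$ and $i\pm1$ (leaving all else fixed) provided the entry $i\mp1$ lies between them in the reading word; if no such configuration occurs, $d_i$ does nothing. Two standard skew tableaux are dual equivalent if one is obtained from the other by a sequence of elementary dual equivalence moves. $\operatorname{Rect}$ is jeu de taquin rectification. For a standard skew tableau $S$ with $m$ cells whose row lengths weakly decrease from top to bottom and $k\ge1$, $S^{(k)}$ is obtained by attaching $k-1$ shifted copies of $S$ to the right of $S$: row $i$ of $S^{(k)}$ begins in the same column as row $i$ of $S$ and consists of the entries of row $i$ of $S$, followed by these entries plus $m$, ..., followed by these entries plus $(k-1)m$. $S$ stabilizes at $k$ if every entry in $[(k-1)m+1,km]$ lies in the same row of $\operatorname{Rect}(S^{(k)})$ as in $S^{(k)}$; $\operatorname{stab}(S)$ is the least $k\ge1$ at which $S$ stabilizes. *)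

theory Defs
  imports Main
begin

text \<open>Cells are (row, column), rows numbered top to bottom, columns left to right
(English convention). A tableau is a finite partial labelling of cells.\<close>

type_synonym cell = "nat \<times> nat"
type_synonym tableau = "cell \<Rightarrow> nat option"

definition young :: "cell set \<Rightarrow> bool" where
  "young D \<longleftrightarrow> finite D \<and>
     (\<forall>i j i' j'. (i, j) \<in> D \<longrightarrow> i' \<le> i \<longrightarrow> j' \<le> j \<longrightarrow> (i', j') \<in> D)"

definition skew_shape :: "cell set \<Rightarrow> bool" where
  "skew_shape C \<longleftrightarrow> (\<exists>lam mu. young lam \<and> young mu \<and> mu \<subseteq> lam \<and> C = lam - mu)"

definition standard :: "tableau \<Rightarrow> bool" where
  "standard T \<longleftrightarrow> skew_shape (dom T) \<and> inj_on T (dom T) \<and> ran T = {1..card (dom T)} \<and>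
     (\<forall>i j. (i, j) \<in> dom T \<longrightarrow> (i, Suc j) \<in> dom T \<longrightarrow> the (T (i, j)) < the (T (i, Suc j))) \<and>
     (\<forall>i j. (i, j) \<in> dom T \<longrightarrow> (Suc i, j) \<in> dom T \<longrightarrow> the (T (i, j)) < the (T (Suc i, j)))"

definition row_len :: "tableau \<Rightarrow> nat \<Rightarrow> nat" where
  "row_len T i = card {j. (i, j) \<in> dom T}"

definition rows_weakly_decreasing :: "tableau \<Rightarrow> bool" where
  "rows_weakly_decreasing T \<longleftrightarrow> (\<forall>i. row_len T (Suc i) \<le> row_len T i)"

definition read_before :: "cell \<Rightarrow> cell \<Rightarrow> bool" where
  "read_before c d \<longleftrightarrow> fst d < fst c \<or> (fst c = fst d \<and> snd c < snd d)"

definition cell_of :: "tableau \<Rightarrow> nat \<Rightarrow> cell" where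
  "cell_of T x = (THE c. T c = Some x)"

definition between :: "tableau \<Rightarrow> nat \<Rightarrow> nat \<Rightarrow> nat \<Rightarrow> bool" where
  "between T x a b \<longleftrightarrow>
     (read_before (cell_of T a) (cell_of T x) \<and> read_before (cell_of T x) (cell_of T b)) \<or>
     (read_before (cell_of T b) (cell_of T x) \<and> read_before (cell_of T x) (cell_of T a))"

definition swap_entries :: "nat \<Rightarrow> nat \<Rightarrow> tableau \<Rightarrow> tableau" where
  "swap_entries a b T = (\<lambda>c. map_option (\<lambda>v. if v = a then b else if v = b then a else v) (T c))"

definition dual_move :: "nat \<Rightarrow> tableau \<Rightarrow> tableau" where
  "dual_move i T =
     (if 1 < i \<and> i - 1 \<in> ran T \<and> i \<in> ran T \<and> i + 1 \<in> ran T then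
        (if between T (i - 1) i (i + 1) then swap_entries i (i + 1) T
         else if between T (i + 1) i (i - 1) then swap_entries i (i - 1) T
         else T)
      else T)"

definition dual_equiv :: "tableau \<Rightarrow> tableau \<Rightarrow> bool" where
  "dual_equiv S T \<longleftrightarrow> (\<lambda>A B. \<exists>i. B = dual_move i A)\<^sup>*\<^sup>* S T"

fun slide_aux :: "nat \<Rightarrow> tableau \<Rightarrow> cell \<Rightarrow> tableau" where
  "slide_aux 0 T h = T"
| "slide_aux (Suc n) T h =
     (let r = (fst h, Suc (snd h)); b = (Suc (fst h), snd h) in
      case (T r, T b) of
        (None, None) \<Rightarrow> T
      | (Some x, None) \<Rightarrow> slide_aux n (T(h := Some x, r := None)) r
      | (None, Some y) \<Rightarrow> slide_aux n (T(h := Some y, b := None)) b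
      | (Some x, Some y) \<Rightarrow>
          (if x < y then slide_aux n (T(h := Some x, r := None)) r
           else slide_aux n (T(h := Some y, b := None)) b))"

definition slide :: "tableau \<Rightarrow> cell \<Rightarrow> tableau" where
  "slide T c = slide_aux (Suc (card (dom T))) T c"

text \<open>Inner shape (cells of mu weakly north-west of some cell of the tableau).\<close>
definition inner :: "tableau \<Rightarrow> cell set" where
  "inner T = {c. c \<notin> dom T \<and> (\<exists>d \<in> dom T. fst c \<le> fst d \<and> snd c \<le> snd d)}"

definition inner_corner :: "tableau \<Rightarrow> cell \<Rightarrow> bool" where
  "inner_corner T c \<longleftrightarrow> c \<in> inner T \<and> (Suc (fst c), snd c) \<notin> inner T \<and> (fst c, Suc (snd c)) \<notin> inner T"

fun rect_aux :: "nat \<Rightarrow> tableau \<Rightarrow> tableau" where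
  "rect_aux 0 T = T"
| "rect_aux (Suc n) T =
     (if inner T = {} then T else rect_aux n (slide T (SOME c. inner_corner T c)))"

definition Rect :: "tableau \<Rightarrow> tableau" where
  "Rect T = rect_aux (card (inner T)) T"

definition row_start :: "tableau \<Rightarrow> nat \<Rightarrow> nat" where
  "row_start S i = (LEAST j. (i, j) \<in> dom S)"

text \<open>S^(k): k copies of S attached row by row, the t-th copy shifted by t*m.\<close>
definition power_tab :: "nat \<Rightarrow> tableau \<Rightarrow> tableau" where
  "power_tab k S = (\<lambda>(i, j).
     (let s = row_start S i; L = row_len S i; m = card (dom S) in
      if 0 < L \<and> s \<le> j \<and> j < s + k * L
      then map_option (\<lambda>v. v + ((j - s) div L) * m) (S (i, s + (j - s) mod L))
      else None))"

definition row_of :: "tableau \<Rightarrow> nat \<Rightarrow> nat" where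
  "row_of T x = fst (cell_of T x)"

definition stabilizes_at :: "tableau \<Rightarrow> nat \<Rightarrow> bool" where
  "stabilizes_at S k \<longleftrightarrow>
     (\<forall>x \<in> {(k - 1) * card (dom S) + 1 .. k * card (dom S)}.
        row_of (Rect (power_tab k S)) x = row_of (power_tab k S) x)"

definition stab :: "tableau \<Rightarrow> nat" where
  "stab S = (LEAST k. 1 \<le> k \<and> stabilizes_at S k)"

end

(* Elementary dual equivalences commute with rectification and act on S^(k) copy by copy.
Hence if T = d_i(S), then T^(k) and Rect(T^(k)) arise from S^(k) and Rect(S^(k)) by the moves with
indices i, i + m, ..., i + (k-1)m, of which only the last one touches the entries of the last copy.
If S stabilizes at k, these entries lie in the same rows of S^(k) and Rect(S^(k)), hence occur in the
same order in both reading words (within a row the order is the numerical one).  So the last move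
permutes the entries of the last copy in the same way in both tableaux, and T stabilizes at k.
The converse holds because d_i is an involution. *)

theory Submission
  imports Defs
begin

text \<open>The work lies in commuting d_i with one slide, that is, with a tableau containing a
  hole. A slide step can disturb the reading order of i - 1, i, i + 1, or the choice of the next
  step, only if these three entries fill a 2x2 block together with the hole. When the hole is the
  upper left cell of such a block with i + 1 opposite to it, the slides of T and d_i(T) run round
  the block in opposite directions, and commutation is restored only after two steps.

  Whole rectifications then match because the inner corners depend only on the set of cells, which
  d_i preserves, so both sides slide into the same corners.

  The row length condition is what makes S^(k) a skew tableau. In S^(k) every copy undergoes the
  same swap. In Rect(S^(k)) the moves for the earlier copies may swap other pairs; this is harmless,
  as they leave the entries of the last copy in place.\<close>

section \<open>Increasing fillings of order-convex sets of cells\<close>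

definition nw :: "cell \<Rightarrow> cell \<Rightarrow> bool" where
  "nw c d \<longleftrightarrow> fst c \<le> fst d \<and> snd c \<le> snd d"

definition convex_cells :: "cell set \<Rightarrow> bool" where
  "convex_cells E \<longleftrightarrow> (\<forall>c\<in>E. \<forall>d\<in>E. \<forall>x. nw c x \<longrightarrow> nw x d \<longrightarrow> x \<in> E)"

text \<open>Entries are compared at all comparable cells rather than at neighbours: across a hole,
  neighbour comparisons no longer generate the others. The entries are arbitrary distinct
  numbers.\<close>

definition increasing :: "tableau \<Rightarrow> bool" where
  "increasing T \<longleftrightarrow> finite (dom T) \<and>
     (\<forall>c d x. T c = Some x \<longrightarrow> T d = Some x \<longrightarrow> c = d) \<and>
     (\<forall>c d x y. T c = Some x \<longrightarrow> T d = Some y \<longrightarrow> nw c d \<longrightarrow> c \<noteq> d \<longrightarrow> x < y)"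

definition skew_tab :: "tableau \<Rightarrow> bool" where
  "skew_tab T \<longleftrightarrow> increasing T \<and> convex_cells (dom T)"

text \<open>The state of a jeu de taquin slide with the hole at h.\<close>

definition punctured :: "tableau \<Rightarrow> cell \<Rightarrow> bool" where
  "punctured T h \<longleftrightarrow> increasing T \<and> h \<notin> dom T \<and> convex_cells (insert h (dom T))"

lemma increasing_inj: "increasing T \<Longrightarrow> T c = Some x \<Longrightarrow> T d = Some x \<Longrightarrow> c = d"
  unfolding increasing_def by blast

lemma increasing_less:
  "increasing T \<Longrightarrow> T c = Some x \<Longrightarrow> T d = Some y \<Longrightarrow> nw c d \<Longrightarrow> c \<noteq> d \<Longrightarrow> x < y"
  unfolding increasing_def by blast

lemma increasing_le:
  "increasing T \<Longrightarrow> T c = Some x \<Longrightarrow> T d = Some y \<Longrightarrow> nw c d \<Longrightarrow> x \<le> y"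
  using increasing_less by fastforce

lemma convex_cellsD:
  "convex_cells E \<Longrightarrow> c \<in> E \<Longrightarrow> d \<in> E \<Longrightarrow> nw c x \<Longrightarrow> nw x d \<Longrightarrow> x \<in> E"
  unfolding convex_cells_def by blast

lemma punctured_between:
  assumes "punctured T h" "c = h \<or> T c \<noteq> None" "d = h \<or> T d \<noteq> None" "nw c x" "nw x d" "x \<noteq> h"
  obtains v where "T x = Some v"
  using convex_cellsD[of "insert h (dom T)" c d x] assms unfolding punctured_def by blast

lemma cell_of_eq: "increasing T \<Longrightarrow> T c = Some x \<Longrightarrow> cell_of T x = c"
  unfolding cell_of_def by (rule the_equality) (auto dest: increasing_inj)


section \<open>Elementary dual equivalence\<close>

text \<open>Refers to positions instead of entries, so that the reading orders in two different
  tableaux can be compared.\<close>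

definition btw :: "cell \<Rightarrow> cell \<Rightarrow> cell \<Rightarrow> bool" where
  "btw x c d \<longleftrightarrow> (read_before c x \<and> read_before x d) \<or> (read_before d x \<and> read_before x c)"

lemma read_before_asym: "read_before c d \<Longrightarrow> \<not> read_before d c"
  unfolding read_before_def by auto

lemma read_before_total: "c \<noteq> d \<Longrightarrow> read_before c d \<or> read_before d c"
  unfolding read_before_def by (cases c; cases d) auto

lemma between_btw:
  assumes "increasing T" "T X = Some x" "T Y = Some y" "T Z = Some z"
  shows "between T x y z = btw X Y Z"
  unfolding between_def btw_def using assms by (simp add: cell_of_eq)

text \<open>The index is written as \<open>a + 1\<close>, so that the move concerns
  \<open>a\<close>, \<open>a + 1\<close>, \<open>a + 2\<close>. The three branches say which of them
  is read in the middle: \<open>a\<close>, \<open>a + 2\<close> or \<open>a + 1\<close>.\<close>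

lemma dual_move_swap:
  assumes "increasing T" "T A = Some a" "T B = Some (a + 1)" "T C = Some (a + 2)" "0 < a"
  shows "dual_move (a + 1) T = (if btw A B C then swap_entries (a + 1) (a + 2) T
     else if btw C B A then swap_entries (a + 1) a T else T)"
proof -
  have "between T a (a+1) (a+2) = btw A B C" "between T (a+2) (a+1) a = btw C B A"
    using between_btw assms by blast+
  moreover have "a \<in> ran T" "a + 1 \<in> ran T" "a + 2 \<in> ran T"
    using assms by (auto intro: ranI)
  ultimately show ?thesis using \<open>0 < a\<close> unfolding dual_move_def by simp
qed

lemma dual_move_trivial:
  "\<not> (1 < i \<and> i - 1 \<in> ran T \<and> i \<in> ran T \<and> i + 1 \<in> ran T) \<Longrightarrow> dual_move i T = T"
  unfolding dual_move_def by presburger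

lemma dual_move_cases:
  fixes i :: nat and T :: tableau
  obtains (trivial) "\<not> (1 < i \<and> i - 1 \<in> ran T \<and> i \<in> ran T \<and> i + 1 \<in> ran T)"
  | (active) a A B C where "i = a + 1" "0 < a" "T A = Some a" "T B = Some (a + 1)" "T C = Some (a + 2)"
proof (cases "1 < i \<and> i - 1 \<in> ran T \<and> i \<in> ran T \<and> i + 1 \<in> ran T")
  case True
  define a where "a = i - 1"
  have "i = a + 1" "0 < a" "i + 1 = a + 2" using True by (auto simp: a_def)
  moreover have "a \<in> ran T" "a + 1 \<in> ran T" "a + 2 \<in> ran T" using True by (simp_all add: a_def)
  moreover then obtain A B C where "T A = Some a" "T B = Some (a + 1)" "T C = Some (a + 2)"
    unfolding ran_def by blast
  ultimately show ?thesis using active by blast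
qed (use trivial in blast)

lemma dom_swap_entries [simp]: "dom (swap_entries a b T) = dom T"
  unfolding swap_entries_def by (auto simp: dom_def)

lemma dom_dual_move [simp]: "dom (dual_move i T) = dom T"
  unfolding dual_move_def by simp

lemma swap_entries_Some:
  "swap_entries a b T c = Some v \<longleftrightarrow>
     T c = Some (if v = a then b else if v = b then a else v)"
  unfolding swap_entries_def by (cases "T c") auto

lemma ran_swap_entries:
  assumes "a \<in> ran T" "b \<in> ran T" shows "ran (swap_entries a b T) = ran T"
proof -
  have "v \<in> ran (swap_entries a b T) \<longleftrightarrow> (if v = a then b else if v = b then a else v) \<in> ran T" for v
    unfolding ran_def by (simp add: swap_entries_Some)
  thus ?thesis using assms by (metis subsetI subset_antisym)
qed

lemma ran_dual_move [simp]: "ran (dual_move i T) = ran T"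
  unfolding dual_move_def by (simp add: ran_swap_entries)

text \<open>No value separates \<open>a\<close> from \<open>Suc a\<close>, so exchanging them
  affects no comparison except the one between their own two cells.\<close>

lemma increasing_swap_entries:
  assumes T: "increasing T" and A: "T A = Some a" and B: "T B = Some (Suc a)"
    and not_nw: "\<not> nw A B"
  shows "increasing (swap_entries a (Suc a) T)"
  unfolding increasing_def
proof (intro conjI allI impI)
  show "finite (dom (swap_entries a (Suc a) T))" using T by (simp add: increasing_def)
next
  fix c d x
  assume "swap_entries a (Suc a) T c = Some x" "swap_entries a (Suc a) T d = Some x"
  thus "c = d" using increasing_inj[OF T] by (auto simp: swap_entries_Some)
next
  fix c d x y
  assume c: "swap_entries a (Suc a) T c = Some x" and d: "swap_entries a (Suc a) T d = Some y"
    and nw: "nw c d" and ne: "c \<noteq> d"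
  have "(if x = a then Suc a else if x = Suc a then a else x)
      < (if y = a then Suc a else if y = Suc a then a else y)"
    using increasing_less[OF T] c d nw ne by (auto simp: swap_entries_Some)
  moreover have "\<not> (x = Suc a \<and> y = a)"
  proof
    assume "x = Suc a \<and> y = a"
    hence "T c = Some a" "T d = Some (Suc a)" using c d by (simp_all add: swap_entries_Some)
    hence "c = A" "d = B" using increasing_inj[OF T] A B by blast+
    thus False using nw not_nw by simp
  qed
  ultimately show "x < y" by (auto split: if_splits)
qed

lemma swap_entries_commute: "swap_entries a b T = swap_entries b a T"
  unfolding swap_entries_def by (auto intro!: ext arg_cong[where f = "\<lambda>f. map_option f _"])

text \<open>Two comparable cells are never swapped: the third entry, read between them, would
  produce a corner of the rectangle spanned by the cells of \<open>a\<close> and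
  \<open>a + 2\<close>. Its entry lies strictly in between, hence is \<open>a + 1\<close>, but
  \<open>a + 1\<close> sits elsewhere.\<close>

lemma skew_tab_dual_move:
  assumes T: "skew_tab T" shows "skew_tab (dual_move i T)"
proof (cases i T rule: dual_move_cases)
  case trivial
  thus ?thesis using T dual_move_trivial by metis
next
  case (active a A B C)
  have inc: "increasing T" and con: "convex_cells (dom T)" using T by (auto simp: skew_tab_def)
  note less = increasing_less[OF inc]
  have ne: "A \<noteq> B" "A \<noteq> C" "B \<noteq> C" using active by auto
  have mid: False if prem: "nw X Y" "nw Y Z" "X \<noteq> Y" "Y \<noteq> Z" "Y \<noteq> W"
    "T X = Some a" "T W = Some (a + 1)" "T Z = Some (a + 2)" for X Y Z W
  proof -
    obtain y where y: "T Y = Some y"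
      using convex_cellsD[OF con _ _ prem(1,2)] prem(6,8) by blast
    have "a < y" "y < a + 2" using less[OF prem(6) y prem(1,3)] less[OF y prem(8) prem(2,4)] .
    hence "y = a + 1" by simp
    thus False using increasing_inj[OF inc _ prem(7)] y prem(5) by blast
  qed
  \<comment> \<open>If \<open>B\<close> were northwest of \<open>C\<close>, the reading order would
    be \<open>C\<close>, \<open>A\<close>, \<open>B\<close>, with \<open>A\<close> strictly above
    and left of \<open>C\<close>. The corner in the row of \<open>C\<close> and the column of
    \<open>A\<close> is not \<open>B\<close>, which lies in a higher row. The second case uses the
    opposite corner.\<close>
  have 1: "\<not> nw B C" if "btw A B C"
  proof
    assume "nw B C"
    moreover have "\<not> nw B A" "\<not> nw C A"
      using less[OF active(4,3)] less[OF active(5,3)] ne by auto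
    ultimately have "nw A (fst C, snd A)" "nw (fst C, snd A) C" "fst A < fst C" "fst B < fst C" "snd A < snd C"
      using that unfolding btw_def nw_def read_before_def by auto
    thus False using mid[of A "(fst C, snd A)" C B] active by (auto simp: prod_eq_iff)
  qed
  have 2: "\<not> nw A B" if "btw C B A"
  proof
    assume "nw A B"
    moreover have "\<not> nw C B" "\<not> nw C A"
      using less[OF active(5,4)] less[OF active(5,3)] ne by auto
    ultimately have "nw A (fst A, snd C)" "nw (fst A, snd C) C" "snd A < snd C" "fst A < fst C" "fst A < fst B"
      using that unfolding btw_def nw_def read_before_def by auto
    thus False using mid[of A "(fst A, snd C)" C B] active by (auto simp: prod_eq_iff)
  qed
  have "increasing (dual_move i T)"
    using 1 2 inc active increasing_swap_entries[OF inc, of B "a + 1" C] increasing_swap_entries[OF inc, of A a B]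
    unfolding active(1) dual_move_swap[OF inc active(3,4,5,2)]
    by (simp add: swap_entries_commute[of "Suc a" a])
  thus ?thesis using con by (simp add: skew_tab_def)
qed


section \<open>Slides\<close>

abbreviation right :: "cell \<Rightarrow> cell" where "right h \<equiv> (fst h, Suc (snd h))"
abbreviation below :: "cell \<Rightarrow> cell" where "below h \<equiv> (Suc (fst h), snd h)"
abbreviation diag :: "cell \<Rightarrow> cell" where "diag h \<equiv> (Suc (fst h), Suc (snd h))"

definition next_hole :: "tableau \<Rightarrow> cell \<Rightarrow> cell option" where
  "next_hole T h = (case (T (right h), T (below h)) of
     (None, None) \<Rightarrow> None
   | (Some x, None) \<Rightarrow> Some (right h)
   | (None, Some y) \<Rightarrow> Some (below h)
   | (Some x, Some y) \<Rightarrow> Some (if x < y then right h else below h))"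

definition shift :: "tableau \<Rightarrow> cell \<Rightarrow> cell \<Rightarrow> tableau" where
  "shift T h c = T(h := T c, c := None)"

lemma slide_aux_Suc:
  "slide_aux (Suc n) T h =
     (case next_hole T h of None \<Rightarrow> T | Some c \<Rightarrow> slide_aux n (shift T h c) c)"
  by (auto simp: next_hole_def shift_def Let_def split: option.split)

declare slide_aux.simps(2) [simp del]

lemma next_hole_cases:
  assumes "next_hole T h = Some c"
  obtains (right) x where "c = right h" "T c = Some x" "\<And>y. T (below h) = Some y \<Longrightarrow> x < y"
  | (below) y where "c = below h" "T c = Some y" "\<And>x. T (right h) = Some x \<Longrightarrow> y \<le> x"
  using assms unfolding next_hole_def by (auto split: option.splits if_splits)

lemma next_hole_None: "next_hole T h = None \<longleftrightarrow> right h \<notin> dom T \<and> below h \<notin> dom T"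
  unfolding next_hole_def by (auto split: option.splits)

lemma shift_Some:
  "h \<noteq> c \<Longrightarrow> shift T h c x = Some v \<longleftrightarrow> (if x = h then T c = Some v else x \<noteq> c \<and> T x = Some v)"
  unfolding shift_def by auto

lemma next_hole_ne: "next_hole T h = Some c \<Longrightarrow> h \<noteq> c \<and> nw h c"
  by (erule next_hole_cases) (auto simp: nw_def prod_eq_iff)

text \<open>Everything southeast of the hole lies beyond its right or its lower neighbour, which is
  filled by convexity; the hole moves to the smaller of the two.\<close>

lemma next_hole_least:
  assumes P: "punctured T h" and n: "next_hole T h = Some c" and c: "T c = Some v"
    and d: "T d = Some w" and nw: "nw h d" and ne: "d \<noteq> c"
  shows "v < w"
proof -
  have inc: "increasing T" and h: "h \<notin> dom T" using P by (auto simp: punctured_def)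
  have dh: "d \<noteq> h" using h d by auto
  have "nw (right h) d \<or> nw (below h) d"
    using nw dh by (cases h; cases d) (auto simp: nw_def)
  hence "\<exists>e u. (e = right h \<or> e = below h) \<and> nw e d \<and> T e = Some u"
  proof
    assume "nw (right h) d"
    moreover then obtain u where "T (right h) = Some u"
      using punctured_between[OF P, of h d "right h"] d by (auto simp: nw_def prod_eq_iff)
    ultimately show ?thesis by blast
  next
    assume "nw (below h) d"
    moreover then obtain u where "T (below h) = Some u"
      using punctured_between[OF P, of h d "below h"] d by (auto simp: nw_def prod_eq_iff)
    ultimately show ?thesis by blast
  qed
  then obtain e u where e: "e = right h \<or> e = below h" "nw e d" "T e = Some u" by blast
  have "v \<le> u" using n
    by (cases rule: next_hole_cases) (use e c in auto)
  moreover have "u \<le> w" using increasing_le[OF inc e(3) d e(2)] .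
  moreover have "v \<noteq> w" using increasing_inj[OF inc c] d ne by blast
  ultimately show ?thesis by simp
qed

lemma insert_dom_shift:
  assumes "next_hole T h = Some c"
  shows "insert c (dom (shift T h c)) = insert h (dom T)"
  using assms next_hole_ne[OF assms]
  by (cases rule: next_hole_cases) (auto simp: shift_def)

text \<open>The entry moved into \<open>h\<close> is the least one southeast of \<open>h\<close>,
  and it exceeds everything northwest of \<open>h\<close> because that is also northwest of
  \<open>c\<close>. The shape with the hole filled in does not change.\<close>

lemma punctured_shift:
  assumes P: "punctured T h" and n: "next_hole T h = Some c"
  shows "punctured (shift T h c) c"
proof -
  have inc: "increasing T" and h: "h \<notin> dom T" using P by (auto simp: punctured_def)
  have hc: "h \<noteq> c" "nw h c" using next_hole_ne[OF n] by auto
  obtain v where v: "T c = Some v" using n by (cases rule: next_hole_cases) auto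
  have "increasing (shift T h c)"
    unfolding increasing_def
  proof (intro conjI allI impI)
    have "finite (insert h (dom T))" using inc by (auto simp: increasing_def)
    thus "finite (dom (shift T h c))"
      using insert_dom_shift[OF n] by (metis finite_insert)
  next
    fix d e x assume "shift T h c d = Some x" "shift T h c e = Some x"
    thus "d = e" using increasing_inj[OF inc, of c x d] increasing_inj[OF inc, of c x e]
      increasing_inj[OF inc, of d x e] hc by (auto simp: shift_Some split: if_splits)
  next
    fix d e x y
    assume d: "shift T h c d = Some x" and e: "shift T h c e = Some y" and nw: "nw d e" and ne: "d \<noteq> e"
    consider "d = h" | "e = h" | "d \<noteq> h" "e \<noteq> h" by blast
    thus "x < y"
    proof cases
      case 1
      thus ?thesis using next_hole_least[OF P n v, of e y] d e nw ne hc v by (auto simp: shift_Some)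
    next
      case 2
      hence "nw d c" using nw hc by (auto simp: nw_def)
      thus ?thesis using 2 d e ne hc increasing_less[OF inc, of d x c y] by (auto simp: shift_Some)
    next
      case 3
      thus ?thesis using increasing_less[OF inc _ _ nw ne] d e hc by (auto simp: shift_Some)
    qed
  qed
  moreover have "c \<notin> dom (shift T h c)" by (simp add: shift_def)
  moreover have "convex_cells (insert c (dom (shift T h c)))"
    using insert_dom_shift[OF n] P by (simp add: punctured_def)
  ultimately show ?thesis by (simp add: punctured_def)
qed

lemma ran_shift:
  assumes P: "punctured T h" and n: "next_hole T h = Some c"
  shows "ran (shift T h c) = ran T"
proof -
  have h: "T h = None" using P by (auto simp: punctured_def)
  have hc: "h \<noteq> c" using next_hole_ne[OF n] by auto
  have "x \<in> ran (shift T h c) \<longleftrightarrow> x \<in> ran T" for x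
  proof -
    have "\<exists>d. shift T h c d = Some x" if "T e = Some x" for e
    proof (cases "e = c")
      case True
      thus ?thesis using that hc by (intro exI[of _ h]) (simp add: shift_Some)
    next
      case False
      thus ?thesis using that h hc by (intro exI[of _ e]) (auto simp: shift_Some)
    qed
    moreover have "\<exists>d. T d = Some x" if "shift T h c e = Some x" for e
      using that shift_Some[OF hc, of T e x] by metis
    ultimately show ?thesis unfolding ran_def by blast
  qed
  thus ?thesis by blast
qed

text \<open>Its size is the termination measure of a slide: it drops at each step, so fuel above
  this size lets the slide run to its end.\<close>

definition ahead :: "tableau \<Rightarrow> cell \<Rightarrow> cell set" where
  "ahead T h = {c \<in> dom T. nw h c}"

lemma card_ahead_shift:
  assumes P: "punctured T h" and n: "next_hole T h = Some c"
  shows "card (ahead (shift T h c) c) < card (ahead T h)"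
proof (rule psubset_card_mono)
  have hc: "h \<noteq> c" "nw h c" using next_hole_ne[OF n] by auto
  show "finite (ahead T h)"
    using P by (auto simp: punctured_def increasing_def ahead_def)
  have "c \<in> dom T" using n by (cases rule: next_hole_cases) auto
  hence "c \<in> ahead T h" "c \<notin> ahead (shift T h c) c"
    using hc by (auto simp: ahead_def shift_def)
  moreover have "ahead (shift T h c) c \<subseteq> ahead T h"
  proof
    fix x assume x: "x \<in> ahead (shift T h c) c"
    hence "x \<noteq> h" using hc by (auto simp: ahead_def nw_def prod_eq_iff)
    thus "x \<in> ahead T h" using x hc by (auto simp: ahead_def nw_def shift_def split: if_splits)
  qed
  ultimately show "ahead (shift T h c) c \<subset> ahead T h" by blast
qed

text \<open>With enough fuel the slide stops only where both neighbours are empty. Such a hole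
  cannot lie between two filled cells, since convexity would fill one of these neighbours; so
  dropping it keeps the shape convex.\<close>

lemma slide_aux_skew_tab:
  "punctured T h \<Longrightarrow> card (ahead T h) < n \<Longrightarrow> skew_tab (slide_aux n T h) \<and> ran (slide_aux n T h) = ran T"
proof (induction n arbitrary: T h)
  case (Suc n)
  show ?case
  proof (cases "next_hole T h")
    case None
    have "convex_cells (dom T)"
      unfolding convex_cells_def
    proof (intro ballI allI impI)
      fix c d x assume cd: "c \<in> dom T" "d \<in> dom T" "nw c x" "nw x d"
      have False if x: "x = h"
      proof -
        have "d \<noteq> h" using cd Suc.prems by (auto simp: punctured_def)
        hence "nw (right h) d \<or> nw (below h) d"
          using cd x by (cases h; cases d) (auto simp: nw_def)
        moreover have "right h \<in> dom T" if "nw (right h) d"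
          using punctured_between[OF Suc.prems(1), of h d "right h"] cd(2) that
          by (auto simp: nw_def prod_eq_iff)
        moreover have "below h \<in> dom T" if "nw (below h) d"
          using punctured_between[OF Suc.prems(1), of h d "below h"] cd(2) that
          by (auto simp: nw_def prod_eq_iff)
        ultimately have "right h \<in> dom T \<or> below h \<in> dom T" by blast
        thus False using None by (simp add: next_hole_None)
      qed
      thus "x \<in> dom T" using punctured_between[OF Suc.prems(1), of c d x] cd by blast
    qed
    thus ?thesis using None Suc.prems by (simp add: slide_aux_Suc skew_tab_def punctured_def)
  next
    case (Some c)
    thus ?thesis
      using Suc.IH[OF punctured_shift[OF Suc.prems(1) Some]] Suc.prems card_ahead_shift[OF _ Some]
        ran_shift[OF _ Some] by (fastforce simp: slide_aux_Suc)
  qed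
qed simp


section \<open>Slides commute with elementary dual equivalences\<close>

text \<open>With i = a + 1, the situation \<open>special\<close> is the only one in which the hole takes different
paths in T and in d_i(T): around the hole h the two paths are right-down and down-right. They
meet again at the cell diagonally below h, after which the two tableaux again differ by d_i. In the
intermediate position \<open>half_special\<close> of the right-down path, the move d_i need not give an
increasing tableau.\<close>

definition special :: "tableau \<Rightarrow> cell \<Rightarrow> nat \<Rightarrow> bool" where
  "special T h a \<longleftrightarrow> T (diag h) = Some (a + 2) \<and>
     (T (right h) = Some a \<and> T (below h) = Some (a + 1) \<or>
      T (right h) = Some (a + 1) \<and> T (below h) = Some a)"

definition half_special :: "tableau \<Rightarrow> cell \<Rightarrow> nat \<Rightarrow> bool" where
  "half_special T h a \<longleftrightarrow> (\<exists>g. h = right g \<and> T g = Some a \<and> T (below g) = Some (a + 1)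
     \<and> T (below h) = Some (a + 2))"

lemma half_specialI:
  "0 < snd h \<Longrightarrow> T (fst h, snd h - 1) = Some a \<Longrightarrow> T (Suc (fst h), snd h - 1) = Some (a + 1) \<Longrightarrow>
   T (below h) = Some (a + 2) \<Longrightarrow> half_special T h a"
  unfolding half_special_def by (rule exI[of _ "(fst h, snd h - 1)"]) simp

section \<open>Reading order and hole path during one slide step\<close>

text \<open>A step to the right keeps the reading order. A step down lifts one entry by a row, past
  the cells to the right in its old row and to the left in its new row. Monotonicity allows a nearby
  value there only in the two excluded blocks, and only for values that differ by exactly 2.\<close>

lemma read_before_shift:
  assumes P: "punctured T h" and n: "next_hole T h = Some c"
    and X: "T X = Some x" and Y: "T Y = Some y" and xy: "x < y" "y \<le> x + 2"
    and ns: "y = x + 2 \<Longrightarrow> \<not> special T h x \<and> \<not> half_special T h x"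
  shows "read_before (if X = c then h else X) (if Y = c then h else Y) = read_before X Y"
proof -
  have inc: "increasing T" and h: "h \<notin> dom T" using P by (auto simp: punctured_def)
  have ne: "X \<noteq> Y" "X \<noteq> h" "Y \<noteq> h" using X Y xy h by auto
  show ?thesis using n
  proof (cases rule: next_hole_cases)
    case (right v)
    thus ?thesis using ne by (auto simp: read_before_def prod_eq_iff)
  next
    case (below v)
    consider "X \<noteq> c" "Y \<noteq> c" | "X = c" "Y \<noteq> c" | "Y = c" "X \<noteq> c" using ne by auto
    thus ?thesis
    proof cases
      case 1
      thus ?thesis by simp
    next
      case 2
      have "\<not> nw Y c" using increasing_less[OF inc Y X] 2 ne xy by auto
      hence 3: "\<not> (fst Y \<le> fst h \<and> snd Y < snd h)" using below by (auto simp: nw_def)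
      \<comment> \<open>The smaller entry is lifted: a larger one to its right forces
        \<open>right h\<close> and \<open>diag h\<close> to be filled, and the chain
        \<open>x < w < z <= y\<close> leaves room only for the \<open>special\<close> block.\<close>
      have 4: "\<not> (fst Y = Suc (fst h) \<and> snd h < snd Y)"
      proof
        assume *: "fst Y = Suc (fst h) \<and> snd h < snd Y"
        obtain w where w: "T (right h) = Some w"
          using punctured_between[OF P, of h Y "right h"] Y * by (auto simp: nw_def prod_eq_iff)
        obtain z where z: "T (diag h) = Some z"
          using punctured_between[OF P, of h Y "diag h"] Y * by (auto simp: nw_def prod_eq_iff)
        have "x < w" using next_hole_least[OF P n _ w] X 2 below by (auto simp: nw_def)
        moreover have "w < z" using increasing_less[OF inc w z] by (simp add: nw_def)
        moreover have "z \<le> y" using increasing_le[OF inc z Y] * by (simp add: nw_def)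
        ultimately have "w = x + 1" "z = x + 2" "y = x + 2" using xy by auto
        thus False using ns w z X 2 below by (simp add: special_def)
      qed
      have "fst Y \<noteq> fst h \<or> snd Y \<noteq> snd h" "fst Y \<noteq> Suc (fst h) \<or> snd Y \<noteq> snd h"
        using 2 below ne by (simp_all add: prod_eq_iff)
      hence "read_before h Y = read_before (below h) Y"
        using 3 4 unfolding read_before_def fst_conv snd_conv by linarith
      thus ?thesis using 2 below by simp
    next
      case 2: 3
      have "\<not> nw c X" using increasing_less[OF inc Y X] 2 ne xy by auto
      hence 3: "\<not> (fst X = Suc (fst h) \<and> snd h < snd X)" using below by (auto simp: nw_def)
      \<comment> \<open>The larger entry is lifted: now the 2x2 block to the left of the hole is
        forced, and \<open>x <= w < z < y\<close> makes it the \<open>half_special\<close>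
        one.\<close>
      have 4: "\<not> (fst X = fst h \<and> snd X < snd h)"
      proof
        assume *: "fst X = fst h \<and> snd X < snd h"
        let ?g = "(fst h, snd h - 1)" and ?k = "(Suc (fst h), snd h - 1)"
        have g: "snd X \<le> snd h - 1" "snd h - 1 \<noteq> snd h" using * by linarith+
        obtain w where w: "T ?g = Some w"
          using punctured_between[OF P, of X h ?g] X * g by (auto simp: nw_def prod_eq_iff)
        have "T (below h) = Some v" using below by simp
        then obtain z where z: "T ?k = Some z"
          using punctured_between[OF P, of X "below h" ?k] X * g by (auto simp: nw_def prod_eq_iff)
        have "x \<le> w" using increasing_le[OF inc X w] * by (auto simp: nw_def)
        moreover have "w < z" using increasing_less[OF inc w z] by (simp add: nw_def)
        moreover have "z < y" using increasing_less[OF inc z Y] * 2 below g by (simp add: nw_def)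
        ultimately have "w = x" "z = x + 1" "y = x + 2" using xy by auto
        thus False using half_specialI[of h T x] ns w z Y 2 * below by auto
      qed
      have "fst X \<noteq> fst h \<or> snd X \<noteq> snd h" "fst X \<noteq> Suc (fst h) \<or> snd X \<noteq> snd h"
        using 2 below ne by (simp_all add: prod_eq_iff)
      hence "read_before X h = read_before X (below h)"
        using 3 4 unfolding read_before_def fst_conv snd_conv by linarith
      thus ?thesis using 2 below by simp
    qed
  qed
qed

lemma btw_cong:
  assumes "read_before A' B' = read_before A B" "read_before A' C' = read_before A C"
    "read_before B' C' = read_before B C" "A \<noteq> B" "A \<noteq> C" "B \<noteq> C" "A' \<noteq> B'" "A' \<noteq> C'" "B' \<noteq> C'"
  shows "btw A' B' C' = btw A B C" "btw C' B' A' = btw C B A"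
  using assms read_before_total read_before_asym unfolding btw_def by metis+

lemma swap_entries_shift:
  "swap_entries a b (shift T h c) = shift (swap_entries a b T) h c"
  unfolding swap_entries_def shift_def by auto

text \<open>The three entries are read in the same order before and after the step, so the same two
  values are swapped, and renaming values commutes with moving them.\<close>

lemma dual_move_shift:
  assumes P: "punctured T h" and n: "next_hole T h = Some c"
    and ns: "\<not> special T h a" "\<not> half_special T h a" and a: "0 < a"
    and A: "T A = Some a" and B: "T B = Some (a + 1)" and C: "T C = Some (a + 2)"
  shows "dual_move (a + 1) (shift T h c) = shift (dual_move (a + 1) T) h c"
proof -
  define f where "f Z = (if Z = c then h else Z)" for Z
  have inc: "increasing T" and h: "h \<notin> dom T" using P by (auto simp: punctured_def)
  have hc: "h \<noteq> c" using next_hole_ne[OF n] by auto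
  have f: "shift T h c (f Z) = Some v" if "T Z = Some v" for Z v
    using that h hc by (auto simp: shift_def f_def)
  have rb: "read_before (f X) (f Y) = read_before X Y"
    if "T X = Some x" "T Y = Some y" "x < y" "y \<le> x + 2" "y = x + 2 \<Longrightarrow> x = a" for X Y x y
    unfolding f_def using read_before_shift[OF P n that(1-4)] that(5) ns by blast
  have ne: "A \<noteq> B" "A \<noteq> C" "B \<noteq> C" using A B C by auto
  have ne': "f A \<noteq> f B" "f A \<noteq> f C" "f B \<noteq> f C" using f[OF A] f[OF B] f[OF C] by auto
  have "read_before (f A) (f B) = read_before A B" "read_before (f A) (f C) = read_before A C"
    "read_before (f B) (f C) = read_before B C"
    using rb[OF A B] rb[OF A C] rb[OF B C] by simp_all
  note btw = btw_cong[OF this ne ne']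
  have "increasing (shift T h c)" using punctured_shift[OF P n] by (simp add: punctured_def)
  thus ?thesis
    using dual_move_swap[of "shift T h c" "f A" a "f B" "f C"] f[OF A] f[OF B] f[OF C] a
      dual_move_swap[OF inc A B C a] btw
    by (simp add: swap_entries_shift)
qed

lemma next_hole_swap_entries:
  assumes "T (right h) = Some a \<Longrightarrow> T (below h) = Some (a + 1) \<Longrightarrow> False"
    and "T (right h) = Some (a + 1) \<Longrightarrow> T (below h) = Some a \<Longrightarrow> False"
  shows "next_hole (swap_entries a (a + 1) T) h = next_hole T h"
  using assms unfolding next_hole_def swap_entries_def
  by (auto split: option.splits)

text \<open>The direction could change only if the two swapped entries were exactly the two
  neighbours of the hole. The third entry would then be read between these neighbours, which forces
  one of the excluded blocks.\<close>

lemma next_hole_dual_move: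
  assumes P: "punctured T h"
    and ns: "\<not> special T h a" "\<not> half_special T h a" and a: "0 < a"
    and A: "T A = Some a" and B: "T B = Some (a + 1)" and C: "T C = Some (a + 2)"
  shows "next_hole (dual_move (a + 1) T) h = next_hole T h"
proof -
  have inc: "increasing T" and h: "h \<notin> dom T" using P by (auto simp: punctured_def)
  note inj = increasing_inj[OF inc] and less = increasing_less[OF inc]
  have ne: "A \<noteq> B" "A \<noteq> C" "B \<noteq> C" "A \<noteq> h" "B \<noteq> h" "C \<noteq> h" using A B C h by auto
  \<comment> \<open>The third entry is the smallest, so it must lie to the left of \<open>h\<close>
    in the row of \<open>h\<close>, as in \<open>half_special\<close>.\<close>
  have 1: False if btw: "btw A B C" and rb: "right h = B \<and> below h = C \<or> right h = C \<and> below h = B"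
  proof -
    have "read_before (below h) A" "read_before A (right h)"
      using btw rb by (auto simp: btw_def read_before_def)
    moreover have "\<not> nw (below h) A" using less[OF B A] less[OF C A] ne rb by auto
    ultimately have A': "fst A = fst h" "snd A < snd h"
      using ne(4) unfolding nw_def read_before_def fst_conv snd_conv prod_eq_iff by linarith+
    let ?g = "(fst h, snd h - 1)" and ?k = "(Suc (fst h), snd h - 1)"
    have dom: "right h \<in> dom T" "below h \<in> dom T" using rb B C by auto
    have g: "snd A \<le> snd h - 1" "snd h - 1 \<noteq> snd h" using A' by linarith+
    obtain w where w: "T ?g = Some w"
      using punctured_between[OF P, of A h ?g] A A' g by (auto simp: nw_def prod_eq_iff)
    obtain z where z: "T ?k = Some z"
      using punctured_between[OF P, of A "below h" ?k] A A' g dom by (auto simp: nw_def prod_eq_iff)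
    obtain y where y: "T (below h) = Some y" "y \<le> a + 2" using rb B C by auto
    have "a \<le> w" using increasing_le[OF inc A w] A' by (auto simp: nw_def)
    moreover have "w < z" using less[OF w z] by (simp add: nw_def)
    moreover have "z < y" using less[OF z y(1)] A' by (simp add: nw_def)
    ultimately have "w = a" "z = a + 1" "y = a + 2" using y by auto
    thus False using half_specialI[of h T a] ns w z y A' by auto
  qed
  \<comment> \<open>The third entry is the largest, so it must lie to the right of
    \<open>below h\<close> in the lower row, as in \<open>special\<close>.\<close>
  have 2: False if btw: "btw C B A" and rb: "right h = A \<and> below h = B \<or> right h = B \<and> below h = A"
  proof -
    have "read_before (below h) C" "read_before C (right h)"
      using btw rb by (auto simp: btw_def read_before_def)
    moreover have "\<not> nw C (right h)" using less[OF C A] less[OF C B] ne rb by auto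
    ultimately have C': "fst C = Suc (fst h)" "snd h < snd C"
      unfolding nw_def read_before_def fst_conv snd_conv by linarith+
    obtain z where z: "T (diag h) = Some z"
      using punctured_between[OF P, of h C "diag h"] C C' by (auto simp: nw_def prod_eq_iff)
    have "z \<le> a + 2" using increasing_le[OF inc z C] C' by (auto simp: nw_def)
    moreover have "a < z" "a + 1 < z"
      using rb less[OF A z] less[OF B z] by (auto simp: nw_def prod_eq_iff)
    ultimately have "z = a + 2" by simp
    thus False using ns(1) z rb A B by (auto simp: special_def)
  qed
  have "next_hole (swap_entries (a + 1) (a + 2) T) h = next_hole T h" if "btw A B C"
    using next_hole_swap_entries[of T h "a + 1"] 1[OF that] inj[OF B] inj[OF C] by fastforce
  moreover have "next_hole (swap_entries (a + 1) a T) h = next_hole T h" if "btw C B A"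
    using next_hole_swap_entries[of T h a] 2[OF that] inj[OF A] inj[OF B]
    unfolding swap_entries_commute[of "a + 1"] by blast
  ultimately show ?thesis unfolding dual_move_swap[OF inc A B C a] by simp
qed

section \<open>The two paths round a special block\<close>

lemma right_then_below:
  assumes "T (right h) = Some x" "T (below h) = Some y" "T (diag h) = Some z" "x < y"
    and "\<And>w. T (right (right h)) = Some w \<Longrightarrow> z < w"
  shows "next_hole T h = Some (right h)" "next_hole (shift T h (right h)) (right h) = Some (diag h)"
    "shift (shift T h (right h)) (right h) (diag h) =
     T(h := Some x, right h := Some z, diag h := None)"
  using assms by (cases h; force simp: next_hole_def shift_def split: option.split)+

lemma below_then_right:
  assumes "T (right h) = Some x" "T (below h) = Some y" "T (diag h) = Some z" "y < x"
    and "\<And>w. T (below (below h)) = Some w \<Longrightarrow> z < w"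
  shows "next_hole T h = Some (below h)" "next_hole (shift T h (below h)) (below h) = Some (diag h)"
    "shift (shift T h (below h)) (below h) (diag h) =
     T(h := Some y, below h := Some z, diag h := None)"
  using assms by (cases h; force simp: next_hole_def shift_def split: option.split)+

text \<open>Since \<open>a + 2\<close> is read between the two neighbours of the hole, the move
  swaps \<open>a\<close> and \<open>a + 1\<close>, and the hole goes round the other way. After two
  steps both tableaux have \<open>a\<close> at \<open>h\<close>, with \<open>a + 1\<close> and
  \<open>a + 2\<close> exchanged at the two neighbours. Now \<open>a\<close> is read between them,
  so the move makes exactly this exchange.\<close>

lemma special_steps:
  assumes P: "punctured T h" and sp: "special T h a" and a: "0 < a"
  defines "D \<equiv> dual_move (a + 1) T"
  obtains c c' where "next_hole T h = Some c" "next_hole (shift T h c) c = Some (diag h)"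
    "next_hole D h = Some c'" "next_hole (shift D h c') c' = Some (diag h)"
    "dual_move (a + 1) (shift (shift T h c) c (diag h)) = shift (shift D h c') c' (diag h)"
    "\<not> half_special (shift (shift T h c) c (diag h)) (diag h) a"
proof -
  have inc: "increasing T" and h: "h \<notin> dom T" using P by (auto simp: punctured_def)
  note inj = increasing_inj[OF inc]
  have C: "T (diag h) = Some (a + 2)" using sp by (simp add: special_def)
  have D: "D = swap_entries (a + 1) a T"
  proof -
    consider "T (right h) = Some a" "T (below h) = Some (a + 1)"
      | "T (right h) = Some (a + 1)" "T (below h) = Some a" using sp by (auto simp: special_def)
    thus ?thesis
      unfolding D_def
      by cases (use dual_move_swap[OF inc _ _ C a] in
          \<open>simp_all add: btw_def read_before_def\<close>)
  qed
  \<comment> \<open>The entry \<open>a\<close> is least southeast of \<open>h\<close>, and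
    \<open>a + 1\<close> and \<open>a + 2\<close> belong to the block; hence the cells beyond the
    block cannot prevent the hole from turning to \<open>diag h\<close>.\<close>
  have big: "a + 2 < w" if "T d = Some w" "nw h d" "d \<noteq> right h" "d \<noteq> below h" "d \<noteq> diag h" for d w
  proof -
    have "\<exists>c. next_hole T h = Some c \<and> T c = Some a"
      using sp by (auto simp: special_def next_hole_def)
    then obtain c where c: "next_hole T h = Some c" "T c = Some a" by blast
    hence "d \<noteq> c" using that by (cases rule: next_hole_cases) auto
    hence "a < w" using next_hole_least[OF P c that(1,2)] by blast
    moreover have "w \<noteq> a + 1" "w \<noteq> a + 2"
      using that sp inj[OF that(1)] unfolding special_def by blast+
    ultimately show ?thesis by simp
  qed
  have bigT: "T (right (right h)) = Some w \<Longrightarrow> a + 2 < w" "T (below (below h)) = Some w \<Longrightarrow> a + 2 < w" for w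
    using big[of "right (right h)" w] big[of "below (below h)" w] by (auto simp: nw_def prod_eq_iff)
  have bigD: "D (right (right h)) = Some w \<Longrightarrow> a + 2 < w" "D (below (below h)) = Some w \<Longrightarrow> a + 2 < w" for w
    using bigT unfolding D swap_entries_Some by (auto split: if_splits)
  have DC: "D (diag h) = Some (a + 2)" using C unfolding D swap_entries_Some by simp
  have out: "D x = T x" "\<And>v. T x = Some v \<Longrightarrow> v \<noteq> a \<and> v \<noteq> a + 1 \<and> v \<noteq> a + 2"
    if "x \<noteq> right h" "x \<noteq> below h" "x \<noteq> diag h" for x
  proof -
    show *: "v \<noteq> a \<and> v \<noteq> a + 1 \<and> v \<noteq> a + 2" if "T x = Some v" for v
      using sp inj[OF that] \<open>x \<noteq> right h\<close> \<open>x \<noteq> below h\<close> \<open>x \<noteq> diag h\<close>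
      unfolding special_def by blast
    show "D x = T x" unfolding D swap_entries_def using * by (cases "T x") auto
  qed
  have dist: "h \<noteq> right h" "h \<noteq> below h" "h \<noteq> diag h" "right h \<noteq> below h" "right h \<noteq> diag h" "below h \<noteq> diag h"
    by (simp_all add: prod_eq_iff)
  have half: "half_special T' (diag h) a \<Longrightarrow> T' (below h) = Some a" for T'
    by (auto simp: half_special_def prod_eq_iff)
  consider (r) "T (right h) = Some a" "T (below h) = Some (a + 1)"
    | (b) "T (right h) = Some (a + 1)" "T (below h) = Some a" using sp by (auto simp: special_def)
  thus ?thesis
  proof cases
    case r
    have Dr: "D (right h) = Some (a + 1)" "D (below h) = Some a"
      using r unfolding D swap_entries_Some by simp_all
    have lt: "a < a + 1" by simp
    note 1 = right_then_below[OF r C lt bigT(1)] and 2 = below_then_right[OF Dr DC lt bigD(2)]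
    let ?T2 = "shift (shift T h (right h)) (right h) (diag h)"
    note eqT2 = 1(3)
    have T2: "?T2 h = Some a" "?T2 (below h) = Some (a + 1)" "?T2 (right h) = Some (a + 2)"
      using 1(3) r dist by simp_all
    have "increasing ?T2"
      using punctured_shift[OF punctured_shift[OF P 1(1)] 1(2)] by (simp add: punctured_def)
    hence "dual_move (a + 1) ?T2 = swap_entries (a + 1) (a + 2) ?T2"
      using dual_move_swap[of ?T2 h a "below h" "right h"] T2 a by (simp add: btw_def read_before_def)
    also have "\<dots> = shift (shift D h (below h)) (below h) (diag h)"
    proof (rule ext)
      fix x
      consider "x = h \<or> x = right h \<or> x = below h \<or> x = diag h"
        | "x \<noteq> h" "x \<noteq> right h" "x \<noteq> below h" "x \<noteq> diag h" by blast
      thus "swap_entries (a + 1) (a + 2) ?T2 x = shift (shift D h (below h)) (below h) (diag h) x"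
      proof cases
        case 1
        thus ?thesis using eqT2 2(3) r Dr dist by (elim disjE) (simp_all add: swap_entries_def)
      next
        case x: 2
        show ?thesis using out[OF x(2-4)] x 1(3) 2(3)
          by (cases "T x") (simp_all add: swap_entries_def)
      qed
    qed
    finally show ?thesis
      using that 1(1,2) 2(1,2) half T2(2) by force
  next
    case b
    have Dr: "D (right h) = Some a" "D (below h) = Some (a + 1)"
      using b unfolding D swap_entries_Some by simp_all
    have lt: "a < a + 1" by simp
    note 1 = below_then_right[OF b C lt bigT(2)] and 2 = right_then_below[OF Dr DC lt bigD(1)]
    let ?T2 = "shift (shift T h (below h)) (below h) (diag h)"
    note eqT2 = 1(3)
    have T2: "?T2 h = Some a" "?T2 (below h) = Some (a + 2)" "?T2 (right h) = Some (a + 1)"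
      using 1(3) b dist by simp_all
    have "increasing ?T2"
      using punctured_shift[OF punctured_shift[OF P 1(1)] 1(2)] by (simp add: punctured_def)
    hence "dual_move (a + 1) ?T2 = swap_entries (a + 1) (a + 2) ?T2"
      using dual_move_swap[of ?T2 h a "right h" "below h"] T2 a by (simp add: btw_def read_before_def)
    also have "\<dots> = shift (shift D h (right h)) (right h) (diag h)"
    proof (rule ext)
      fix x
      consider "x = h \<or> x = right h \<or> x = below h \<or> x = diag h"
        | "x \<noteq> h" "x \<noteq> right h" "x \<noteq> below h" "x \<noteq> diag h" by blast
      thus "swap_entries (a + 1) (a + 2) ?T2 x = shift (shift D h (right h)) (right h) (diag h) x"
      proof cases
        case 1
        thus ?thesis using eqT2 2(3) b Dr dist by (elim disjE) (simp_all add: swap_entries_def)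
      next
        case x: 2
        show ?thesis using out[OF x(2-4)] x 1(3) 2(3)
          by (cases "T x") (simp_all add: swap_entries_def)
      qed
    qed
    finally show ?thesis
      using that 1(1,2) 2(1,2) half T2(2) by force
  qed
qed

text \<open>After a step to the right, the bad position comes from a special block. After a step
  down, the entry just lifted would lie between \<open>a\<close> on its left and
  \<open>a + 2\<close> below, hence be \<open>a + 1\<close>, whose place is already taken.\<close>

lemma not_half_special_shift:
  assumes P: "punctured T h" and n: "next_hole T h = Some c" and ns: "\<not> special T h a"
  shows "\<not> half_special (shift T h c) c a"
proof
  assume "half_special (shift T h c) c a"
  then obtain g where g: "c = right g" "shift T h c g = Some a"
    "shift T h c (below g) = Some (a + 1)" "shift T h c (below c) = Some (a + 2)"
    unfolding half_special_def by blast
  have inc: "increasing T" using P by (simp add: punctured_def)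
  have hc: "h \<noteq> c" using next_hole_ne[OF n] by simp
  show False using n
  proof (cases rule: next_hole_cases)
    case (right v)
    hence "g = h" using g by (simp add: prod_eq_iff)
    have "T (right h) = Some a" "T (below h) = Some (a + 1)" "T (diag h) = Some (a + 2)"
      using g(2-4) unfolding \<open>g = h\<close> right(1) by (auto simp: shift_def prod_eq_iff split: if_splits)
    thus False using ns by (simp add: special_def)
  next
    case (below v)
    have "g \<noteq> h" "below g \<noteq> h" "below c \<noteq> h" using g(1) below(1) by (auto simp: prod_eq_iff)
    hence "T g = Some a" "T (below g) = Some (a + 1)" "T (below c) = Some (a + 2)"
      using g(2-4) unfolding shift_Some[OF hc] by simp_all
    moreover from this have "a < v" "v < a + 2"
      using increasing_less[OF inc _ below(2)] increasing_less[OF inc below(2)] g(1)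
      by (auto simp: nw_def prod_eq_iff)
    moreover from this have "v = a + 1" by simp
    ultimately have "c = below g" using increasing_inj[OF inc below(2)] by simp
    thus False using g(1) by (simp add: prod_eq_iff)
  qed
qed

text \<open>Induction on the fuel, with the absence of \<open>half_special\<close> as invariant. It
  is a strong induction because a special block is crossed in two steps at once.\<close>

lemma slide_aux_dual_move:
  assumes "punctured T h" "\<not> half_special T h (i - 1)" "card (ahead T h) < n"
  shows "slide_aux n (dual_move i T) h = dual_move i (slide_aux n T h)"
proof (cases "1 < i \<and> i - 1 \<in> ran T \<and> i \<in> ran T \<and> i + 1 \<in> ran T")
  case False
  thus ?thesis using slide_aux_skew_tab[OF assms(1,3)] dual_move_trivial by metis
next
  case True
  define a where "a = i - 1"
  have a: "i = a + 1" "0 < a" "a \<in> ran T" "a + 1 \<in> ran T" "a + 2 \<in> ran T"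
    using True by (simp_all add: a_def)
  have "\<not> half_special T h a" using assms(2) a by simp
  with assms(1,3) a(3-5) show ?thesis
    unfolding a(1)
  proof (induction n arbitrary: T h rule: less_induct)
    case (less n)
    from less.prems obtain A B C where ABC: "T A = Some a" "T B = Some (a + 1)" "T C = Some (a + 2)"
      unfolding ran_def by blast
    from less.prems obtain m where n: "n = Suc m" by (cases n) auto
    note P = less.prems(1)
    show ?case
    proof (cases "special T h a")
      case False
      note ns = False less.prems(6)
      note nh = next_hole_dual_move[OF P ns a(2) ABC]
      show ?thesis
      proof (cases "next_hole T h")
        case None
        thus ?thesis using nh by (simp add: n slide_aux_Suc)
      next
        case (Some c)
        have "slide_aux m (dual_move (a + 1) (shift T h c)) c = dual_move (a + 1) (slide_aux m (shift T h c) c)"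
          using less.IH[of m "shift T h c" c] less.prems n punctured_shift[OF P Some] ran_shift[OF P Some]
            card_ahead_shift[OF P Some] not_half_special_shift[OF P Some False] by simp
        thus ?thesis using nh Some dual_move_shift[OF P Some ns a(2) ABC]
          by (simp add: n slide_aux_Suc)
      qed
    next
      case True
      from special_steps[OF P True a(2)] obtain c c' where
        c: "next_hole T h = Some c" "next_hole (shift T h c) c = Some (diag h)"
        "next_hole (dual_move (a + 1) T) h = Some c'"
        "next_hole (shift (dual_move (a + 1) T) h c') c' = Some (diag h)" and
        eq: "dual_move (a + 1) (shift (shift T h c) c (diag h)) =
          shift (shift (dual_move (a + 1) T) h c') c' (diag h)" and
        nh: "\<not> half_special (shift (shift T h c) c (diag h)) (diag h) a" .
      let ?T2 = "shift (shift T h c) c (diag h)"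
      note P1 = punctured_shift[OF P c(1)]
      have "card (ahead ?T2 (diag h)) + 2 < n"
        using card_ahead_shift[OF P c(1)] card_ahead_shift[OF P1 c(2)] less.prems(2) by simp
      then obtain k where k: "n = Suc (Suc k)" "card (ahead ?T2 (diag h)) < k"
        by (metis add_2_eq_Suc' less_Suc_eq_0_disj less_imp_Suc_add Suc_less_eq not_less0 old.nat.exhaust)
      have "slide_aux k (dual_move (a + 1) ?T2) (diag h) = dual_move (a + 1) (slide_aux k ?T2 (diag h))"
        using less.IH[of k ?T2 "diag h"] less.prems k nh punctured_shift[OF P1 c(2)]
          ran_shift[OF P c(1)] ran_shift[OF P1 c(2)] by simp
      thus ?thesis using c eq by (simp add: k slide_aux_Suc)
    qed
  qed
qed


section \<open>Rectification\<close>

text \<open>By convexity nothing northwest of the corner is filled, which rules out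
  \<open>half_special\<close>: that needs an entry to the left of the hole. Its right and lower
  neighbours are outside the inner region, hence filled as soon as something lies beyond them; this
  gives convexity with the corner added.\<close>

lemma inner_corner_punctured:
  assumes T: "skew_tab T" and c: "inner_corner T c"
  shows "punctured T c \<and> \<not> half_special T c a"
proof -
  have inc: "increasing T" and con: "convex_cells (dom T)" using T by (auto simp: skew_tab_def)
  from c obtain d where d: "c \<notin> dom T" "d \<in> dom T" "nw c d"
    and corner: "below c \<notin> inner T" "right c \<notin> inner T"
    unfolding inner_corner_def inner_def nw_def by blast
  have before: "e \<notin> dom T" if "nw e c" for e
    using convex_cellsD[OF con _ d(2) that d(3)] d(1) by blast
  have after: "x \<in> dom T" if "nw c x" "x \<noteq> c" "nw x e" "e \<in> dom T" for x e
  proof -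
    have "nw (right c) x \<or> nw (below c) x"
      using that(1,2) by (cases c; cases x) (auto simp: nw_def)
    then obtain b where b: "b = right c \<or> b = below c" "nw b x" by blast
    have "nw b e" using b(2) that(3) by (auto simp: nw_def)
    hence "b \<in> dom T \<or> b \<in> inner T" using that(4) unfolding inner_def nw_def by blast
    hence "b \<in> dom T" using corner b(1) by blast
    thus ?thesis using convex_cellsD[OF con _ that(4) b(2) that(3)] by blast
  qed
  have "convex_cells (insert c (dom T))"
    unfolding convex_cells_def
  proof (intro ballI allI impI)
    fix x y z assume *: "x \<in> insert c (dom T)" "y \<in> insert c (dom T)" "nw x z" "nw z y"
    show "z \<in> insert c (dom T)"
    proof (cases "y = c")
      case True
      hence "x = c" using before[of x] * by (auto simp: nw_def)
      thus ?thesis using * True by (auto simp: nw_def prod_eq_iff)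
    next
      case False
      thus ?thesis using after[of z y] * convex_cellsD[OF con, of x y z] by blast
    qed
  qed
  moreover have "\<not> half_special T c a"
  proof
    assume "half_special T c a"
    then obtain g where "c = right g" "T g = Some a" by (auto simp: half_special_def)
    thus False using before[of g] by (auto simp: nw_def)
  qed
  ultimately show ?thesis using inc d by (simp add: punctured_def)
qed

lemma slide_dual_move:
  assumes T: "skew_tab T" and c: "inner_corner T c"
  shows "skew_tab (slide T c)" "ran (slide T c) = ran T"
    "slide (dual_move i T) c = dual_move i (slide T c)"
proof -
  have P: "punctured T c" "\<not> half_special T c (i - 1)" using inner_corner_punctured[OF T c] by auto
  have "finite (dom T)" using T by (simp add: skew_tab_def increasing_def)
  hence "card (ahead T c) < Suc (card (dom T))"
    by (metis (no_types, lifting) ahead_def card_mono less_Suc_eq_le mem_Collect_eq subsetI)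
  thus "skew_tab (slide T c)" "ran (slide T c) = ran T"
    "slide (dual_move i T) c = dual_move i (slide T c)"
    using slide_aux_skew_tab[OF P(1)] slide_aux_dual_move[OF P] by (simp_all add: slide_def)
qed

text \<open>An inner cell with the largest sum of row and column is a corner. This guarantees that
  the choice made by \<open>SOME\<close> in \<open>rect_aux\<close> is a genuine corner.\<close>

lemma ex_inner_corner:
  assumes "finite (dom T)" "inner T \<noteq> {}" shows "\<exists>c. inner_corner T c"
proof -
  have "inner T \<subseteq> (\<Union>d\<in>dom T. {..fst d} \<times> {..snd d})" by (auto simp: inner_def)
  hence fin: "finite (inner T)" using assms(1) finite_subset by fastforce
  define f where "f c = fst c + snd c" for c :: cell
  have "Max (f ` inner T) \<in> f ` inner T" using fin assms(2) by simp
  then obtain c where c: "c \<in> inner T" "f c = Max (f ` inner T)" by auto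
  have "f d \<le> f c" if "d \<in> inner T" for d using c(2) fin that by simp
  moreover have "\<not> f (right c) \<le> f c" "\<not> f (below c) \<le> f c" by (simp_all add: f_def)
  ultimately show ?thesis using c(1) unfolding inner_corner_def by blast
qed

lemma inner_dual_move [simp]: "inner (dual_move i T) = inner T"
  by (simp add: inner_def)

lemma inner_corner_dual_move [simp]: "inner_corner (dual_move i T) = inner_corner T"
  by (simp add: inner_corner_def fun_eq_iff)

lemma rect_aux_dual_move:
  "skew_tab T \<Longrightarrow> skew_tab (rect_aux n T) \<and> ran (rect_aux n T) = ran T \<and>
     rect_aux n (dual_move i T) = dual_move i (rect_aux n T)"
proof (induction n arbitrary: T)
  case (Suc n)
  show ?case
  proof (cases "inner T = {}")
    case False
    define c where "c = (SOME c. inner_corner T c)"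
    have "finite (dom T)" using Suc.prems by (simp add: skew_tab_def increasing_def)
    hence "inner_corner T c" unfolding c_def using someI_ex ex_inner_corner False by metis
    note sl = slide_dual_move[OF Suc.prems this]
    show ?thesis using Suc.IH[OF sl(1)] False sl(2,3) by (simp flip: c_def)
  qed (use Suc.prems in simp)
qed simp

lemma Rect_dual_move:
  assumes "skew_tab T"
  shows "skew_tab (Rect T)" "ran (Rect T) = ran T" "Rect (dual_move i T) = dual_move i (Rect T)"
  using rect_aux_dual_move[OF assms] by (simp_all add: Rect_def)


section \<open>Powers of a tableau\<close>

definition row_standard :: "tableau \<Rightarrow> bool" where
  "row_standard S \<longleftrightarrow> skew_tab S \<and> ran S = {1..card (dom S)} \<and> rows_weakly_decreasing S"

text \<open>The place of a cell in copy \<open>t\<close>, the copies being counted from 0.\<close>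

definition lift :: "tableau \<Rightarrow> nat \<Rightarrow> cell \<Rightarrow> cell" where
  "lift S t c = (fst c, snd c + t * row_len S (fst c))"

lemma row_interval:
  assumes S: "skew_tab S" and ne: "(i, j0) \<in> dom S"
  shows "(i, j) \<in> dom S \<longleftrightarrow> row_start S i \<le> j \<and> j < row_start S i + row_len S i"
    and "0 < row_len S i"
proof -
  define R where "R = {j. (i, j) \<in> dom S}"
  have "finite (dom S)" using S by (simp add: skew_tab_def increasing_def)
  hence "finite (snd ` dom S)" by simp
  moreover have "R \<subseteq> snd ` dom S" by (force simp: R_def)
  ultimately have fin: "finite R" by (rule rev_finite_subset)
  have ne': "R \<noteq> {}" using ne by (auto simp: R_def)
  have s: "row_start S i = Min R"
    unfolding row_start_def
    by (rule Least_equality) (use Min_in[OF fin ne'] Min_le[OF fin] in \<open>simp_all add: R_def\<close>)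
  have mem: "x \<in> R \<longleftrightarrow> (i, x) \<in> dom S" for x by (simp add: R_def)
  have "(i, Min R) \<in> dom S" "(i, Max R) \<in> dom S"
    using Min_in[OF fin ne'] Max_in[OF fin ne'] by (simp_all only: mem)
  hence in_R: "x \<in> R" if "Min R \<le> x" "x \<le> Max R" for x
    unfolding mem using convex_cellsD[of "dom S" "(i, Min R)" "(i, Max R)" "(i, x)"] S that
    by (simp add: skew_tab_def nw_def)
  have R: "R = {Min R..Max R}"
  proof
    show "R \<subseteq> {Min R..Max R}" by (rule subsetI) (simp add: fin)
    show "{Min R..Max R} \<subseteq> R" by (rule subsetI) (rule in_R, simp_all)
  qed
  have "Min R \<le> Max R" using fin ne' by simp
  moreover have "row_len S i = Suc (Max R) - Min R"
    unfolding row_len_def using R by (metis R_def card_atLeastAtMost)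
  moreover have "(i, j) \<in> dom S \<longleftrightarrow> j \<in> {Min R..Max R}" using R mem by blast
  ultimately show "(i, j) \<in> dom S \<longleftrightarrow> row_start S i \<le> j \<and> j < row_start S i + row_len S i"
    "0 < row_len S i"
    using s by auto
qed

text \<open>Together with its converse \<open>power_tab_SomeE\<close>, this replaces the
  \<open>div\<close> and \<open>mod\<close> of the definition by a pair of copy number and cell of
  \<open>S\<close>.\<close>

lemma power_tab_lift:
  assumes S: "skew_tab S" and c: "S c = Some v" and t: "t < k"
  shows "power_tab k S (lift S t c) = Some (v + t * card (dom S))"
proof -
  obtain i j where ij: "c = (i, j)" by (cases c)
  have "(i, j) \<in> dom S" using c ij by auto
  note row = row_interval[OF S this]
  let ?L = "row_len S i" and ?s = "row_start S i"
  have "?s \<le> j" "j < ?s + ?L" using row \<open>(i, j) \<in> dom S\<close> by auto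
  then obtain x where x: "j = ?s + x" "x < ?L" by (metis le_Suc_ex nat_add_left_cancel_less)
  hence "(x + t * ?L) div ?L = t" "(x + t * ?L) mod ?L = x" by auto
  moreover have "Suc t * ?L \<le> k * ?L" using t by (intro mult_le_mono1) simp
  ultimately show ?thesis
    using x row(2) c ij by (simp add: power_tab_def lift_def Let_def)
qed

lemma power_tab_SomeE:
  assumes S: "skew_tab S" and d: "power_tab k S d = Some w"
  obtains t c v where "t < k" "S c = Some v" "d = lift S t c" "w = v + t * card (dom S)"
proof -
  obtain i j where ij: "d = (i, j)" by (cases d)
  let ?L = "row_len S i" and ?s = "row_start S i"
  define t where "t = (j - ?s) div ?L"
  define c where "c = (i, ?s + (j - ?s) mod ?L)"
  have 1: "0 < ?L" "?s \<le> j" "j < ?s + k * ?L"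
    and 2: "map_option (\<lambda>v. v + t * card (dom S)) (S c) = Some w"
    using d by (auto simp: ij power_tab_def Let_def c_def t_def split: if_splits)
  from 2 obtain v where "S c = Some v" "w = v + t * card (dom S)" by auto
  moreover have "t < k" using 1 by (simp add: t_def less_mult_imp_div_less mult.commute)
  moreover have "?s + ((j - ?s) mod ?L + (j - ?s) div ?L * ?L) = j"
    by (subst mod_div_mult_eq) (use 1(2) in simp)
  hence "d = lift S t c" by (simp only: ij lift_def c_def t_def fst_conv snd_conv add.assoc)
  ultimately show ?thesis using that by blast
qed

lemma block_less: "v \<le> m \<Longrightarrow> 0 < v' \<Longrightarrow> t < t' \<Longrightarrow> v + t * m < v' + t' * (m::nat)"
proof -
  assume "v \<le> m" "0 < v'" "t < t'"
  moreover from this have "Suc t * m \<le> t' * m" by (intro mult_le_mono1) simp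
  ultimately show ?thesis by simp
qed

text \<open>Division with remainder, the remainders being taken from 1 to \<open>m\<close> like the
  entries of \<open>S\<close>.\<close>

lemma block_unique:
  "v \<le> m \<Longrightarrow> 0 < v \<Longrightarrow> v' \<le> m \<Longrightarrow> 0 < v' \<Longrightarrow> v + t * m = v' + t' * (m::nat) \<Longrightarrow> t = t' \<and> v = v'"
  using block_less[of v m v' t t'] block_less[of v' m v t' t] by (cases t t' rule: linorder_cases) auto

lemma row_standard_range: "row_standard S \<Longrightarrow> S c = Some v \<Longrightarrow> 0 < v \<and> v \<le> card (dom S)"
  unfolding row_standard_def by (metis One_nat_def Suc_le_eq atLeastAtMost_iff ranI)

lemma row_len_antimono: "rows_weakly_decreasing S \<Longrightarrow> i \<le> j \<Longrightarrow> row_len S j \<le> row_len S i"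
  unfolding rows_weakly_decreasing_def by (metis lift_Suc_antimono_le)

lemma row_len_pos:
  assumes "skew_tab S" "0 < row_len S i" shows "\<exists>j. (i, j) \<in> dom S"
proof (rule ccontr)
  assume "\<nexists>j. (i, j) \<in> dom S"
  hence "{j. (i, j) \<in> dom S} = {}" by blast
  thus False using assms(2) by (metis card.empty less_irrefl row_len_def)
qed

text \<open>Otherwise an end of one row and an end of the other would enclose, in the northwest
  order, a cell outside its row interval.\<close>

lemma row_bounds_antimono:
  assumes S: "skew_tab S" and i: "(i, j) \<in> dom S" and i': "(i', j') \<in> dom S" and le: "i \<le> i'"
  shows "row_start S i' \<le> row_start S i" "row_start S i' + row_len S i' \<le> row_start S i + row_len S i"
proof -
  have con: "convex_cells (dom S)" using S by (simp add: skew_tab_def)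
  let ?s = "row_start S i" and ?s' = "row_start S i'"
    and ?e = "row_start S i + row_len S i - 1" and ?e' = "row_start S i' + row_len S i' - 1"
  note r = row_interval[OF S i] and r' = row_interval[OF S i']
  have ends: "(i, ?s) \<in> dom S" "(i', ?s') \<in> dom S" "(i', ?e') \<in> dom S"
    using r(2) r'(2) by (simp_all only: r(1) r'(1)) auto
  show 1: "?s' \<le> ?s"
  proof (rule ccontr)
    assume "\<not> ?s' \<le> ?s"
    hence "(i', ?s) \<in> dom S"
      using convex_cellsD[OF con ends(1,2), of "(i', ?s)"] le by (simp add: nw_def)
    thus False using r'(1) \<open>\<not> ?s' \<le> ?s\<close> by simp
  qed
  show "?s' + row_len S i' \<le> ?s + row_len S i"
  proof (rule ccontr)
    assume *: "\<not> ?thesis"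
    hence "(i, ?e') \<in> dom S"
      using convex_cellsD[OF con ends(1,3), of "(i, ?e')"] le r(2) by (simp add: nw_def)
    hence "?e' < ?s + row_len S i" using r(1) by blast
    thus False using r'(2) * by linarith
  qed
qed

text \<open>A cell southeast of another lies in the same or a later copy. Within one copy the upper
  row is shifted at least as far as the lower one, so comparable cells come from comparable cells of
  \<open>S\<close>. For convexity, the starts and ends of the extended rows still weakly decrease
  downwards.\<close>

lemma skew_tab_power_tab:
  assumes S: "row_standard S" shows "skew_tab (power_tab k S)"
proof -
  have st: "skew_tab S" and rows: "rows_weakly_decreasing S" using S by (auto simp: row_standard_def)
  have inc: "increasing S" using st by (simp add: skew_tab_def)
  let ?P = "power_tab k S" and ?m = "card (dom S)"
  have "finite (dom ?P)"
  proof (rule finite_subset)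
    show "dom ?P \<subseteq> (\<lambda>(t, c). lift S t c) ` ({..<k} \<times> dom S)"
      by (force elim!: power_tab_SomeE[OF st])
    show "finite ((\<lambda>(t, c). lift S t c) ` ({..<k} \<times> dom S))"
      using inc by (simp add: increasing_def)
  qed
  moreover have "c = d" if cd: "?P c = Some x" "?P d = Some x" for c d x
  proof -
    from cd(1) obtain t c0 v where 1: "S c0 = Some v" "c = lift S t c0" "x = v + t * ?m"
      by (rule power_tab_SomeE[OF st])
    from cd(2) obtain t' d0 v' where 2: "S d0 = Some v'" "d = lift S t' d0" "x = v' + t' * ?m"
      by (rule power_tab_SomeE[OF st])
    have "t = t' \<and> v = v'"
      using block_unique row_standard_range[OF S 1(1)] row_standard_range[OF S 2(1)] 1(3) 2(3) by metis
    thus ?thesis using 1 2 increasing_inj[OF inc] by metis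
  qed
  moreover have "x < y" if cd: "?P c = Some x" "?P d = Some y" and nw: "nw c d" "c \<noteq> d" for c d x y
  proof -
    from cd(1) obtain t c0 v where 1: "S c0 = Some v" "c = lift S t c0" "x = v + t * ?m"
      by (rule power_tab_SomeE[OF st])
    from cd(2) obtain t' d0 v' where 2: "S d0 = Some v'" "d = lift S t' d0" "y = v' + t' * ?m"
      by (rule power_tab_SomeE[OF st])
    have le: "fst c0 \<le> fst d0" "snd c \<le> snd d" using nw 1 2 by (auto simp: nw_def lift_def)
    have "(fst c0, snd c0) \<in> dom S" "(fst d0, snd d0) \<in> dom S" using 1 2 by auto
    note row = row_interval[OF st this(1)] and row' = row_interval[OF st this(2)]
      and mono = row_bounds_antimono[OF st this le(1)] row_len_antimono[OF rows le(1)]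
      and in_dom = this
    have c0: "row_start S (fst c0) \<le> snd c0" "snd d0 < row_start S (fst d0) + row_len S (fst d0)"
      using row(1) row'(1) in_dom by blast+
    \<comment> \<open>Otherwise \<open>d\<close> lies left of the start of copy
      \<open>t' + 1\<close> in its row, which is weakly left of the start of copy \<open>t\<close>
      in the row of \<open>c\<close>.\<close>
    have "t \<le> t'"
    proof (rule ccontr)
      assume "\<not> t \<le> t'"
      hence "Suc t' * row_len S (fst d0) \<le> t * row_len S (fst c0)" using mono(3) by (intro mult_le_mono) auto
      hence "snd d < snd c" using c0 mono(1) 1(2) 2(2) by (simp add: lift_def)
      thus False using le by simp
    qed
    moreover have ?thesis if "t < t'"
      using block_less[OF _ _ that] row_standard_range[OF S 1(1)] row_standard_range[OF S 2(1)] 1(3) 2(3) by simp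
    moreover have ?thesis if t: "t = t'"
    proof -
      have "t * row_len S (fst d0) \<le> t * row_len S (fst c0)" using mono(3) by simp
      moreover have "snd c0 + t * row_len S (fst c0) \<le> snd d0 + t * row_len S (fst d0)"
        using le(2) 1(2) 2(2) t by (simp add: lift_def)
      ultimately have "snd c0 \<le> snd d0" by linarith
      hence "nw c0 d0" using le(1) by (simp add: nw_def)
      moreover have "c0 \<noteq> d0" using nw(2) 1(2) 2(2) t by auto
      ultimately show ?thesis using increasing_less[OF inc 1(1) 2(1)] 1(3) 2(3) t by simp
    qed
    ultimately show ?thesis by fastforce
  qed
  ultimately have "increasing ?P" unfolding increasing_def by blast
  moreover have "convex_cells (dom ?P)"
    unfolding convex_cells_def
  proof (intro ballI allI impI)
    fix c d x assume cd: "c \<in> dom ?P" "d \<in> dom ?P" and nw: "nw c x" "nw x d"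
    from cd(1) obtain t c0 v where 1: "S c0 = Some v" "c = lift S t c0"
      by (auto elim: power_tab_SomeE[OF st])
    from cd(2) obtain t' d0 v' where 2: "t' < k" "S d0 = Some v'" "d = lift S t' d0"
      by (auto elim: power_tab_SomeE[OF st])
    have C: "(fst c0, snd c0) \<in> dom S" and D: "(fst d0, snd d0) \<in> dom S" using 1 2 by auto
    obtain i j where x: "x = (i, j)" by (cases x)
    have i: "fst c0 \<le> i" "i \<le> fst d0" using nw x 1 2 by (auto simp: nw_def lift_def)
    note row = row_interval[OF st C] and row' = row_interval[OF st D]
    have L: "row_len S (fst d0) \<le> row_len S i" using row_len_antimono[OF rows i(2)] .
    hence Li: "0 < row_len S i" using row'(2) by simp
    then obtain j0 where X: "(i, j0) \<in> dom S" using row_len_pos[OF st] by blast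
    note m1 = row_bounds_antimono[OF st C X i(1)] and m2 = row_bounds_antimono[OF st X D i(2)]
    let ?s = "row_start S i" and ?L = "row_len S i"
    have "row_start S (fst c0) \<le> snd c0" using row(1) C by blast
    moreover have "snd c0 \<le> j" using nw(1) x 1 by (simp add: nw_def lift_def)
    ultimately have s: "?s \<le> j" using m1(1) by simp
    have "j \<le> snd d0 + t' * row_len S (fst d0)" using nw(2) x 2 by (simp add: nw_def lift_def)
    moreover have "snd d0 < row_start S (fst d0) + row_len S (fst d0)" using row'(1) D by blast
    hence "snd d0 + t' * row_len S (fst d0)
        < row_start S (fst d0) + row_len S (fst d0) + t' * row_len S (fst d0)" by simp
    ultimately have "j < row_start S (fst d0) + row_len S (fst d0) + t' * row_len S (fst d0)" by simp
    also have "\<dots> \<le> ?s + ?L + t' * ?L"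
      by (rule add_le_mono[OF m2(2) mult_le_mono2[OF L]])
    also have "\<dots> = ?s + Suc t' * ?L" by simp
    also have "\<dots> \<le> ?s + k * ?L" using 2(1) by (intro add_left_mono mult_le_mono1) simp
    finally have e: "j < ?s + k * ?L" .
    have "(i, ?s + (j - ?s) mod ?L) \<in> dom S" unfolding row_interval(1)[OF st X] using Li by simp
    then obtain w where "S (i, ?s + (j - ?s) mod ?L) = Some w" by blast
    thus "x \<in> dom ?P" using s e Li by (auto simp: x power_tab_def Let_def)
  qed
  ultimately show ?thesis by (simp add: skew_tab_def)
qed

lemma dom_power_tab:
  assumes S: "skew_tab S" shows "dom (power_tab k S) = (\<Union>t<k. lift S t ` dom S)"
proof (intro equalityI subsetI)
  fix x assume "x \<in> dom (power_tab k S)"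
  thus "x \<in> (\<Union>t<k. lift S t ` dom S)" by (blast elim: power_tab_SomeE[OF S])
next
  fix x assume "x \<in> (\<Union>t<k. lift S t ` dom S)"
  thus "x \<in> dom (power_tab k S)" by (blast dest: power_tab_lift[OF S])
qed

lemma row_len_cong: "dom S = dom T \<Longrightarrow> row_len S = row_len T"
  by (simp add: row_len_def fun_eq_iff)

lemma lift_cong: "dom S = dom T \<Longrightarrow> lift S = lift T"
  using row_len_cong[of S T] by (simp add: lift_def fun_eq_iff)

lemma row_standard_dual_move: "row_standard S \<Longrightarrow> row_standard (dual_move i S)"
  using row_len_cong[of "dual_move i S" S]
  by (simp add: row_standard_def skew_tab_dual_move rows_weakly_decreasing_def)

text \<open>d_i swaps entries depending only on the order of i - 1, i, i + 1 in the reading word; p = q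
encodes that d_i does nothing.\<close>

lemma dual_move_uniform:
  assumes "increasing T" "T A = Some a" "T B = Some (a + 1)" "T C = Some (a + 2)" "0 < a"
  obtains p q where "p \<le> 2" "q \<le> 2"
    "\<And>T' A' B' C' a'. increasing T' \<Longrightarrow> T' A' = Some a' \<Longrightarrow> T' B' = Some (a' + 1) \<Longrightarrow>
      T' C' = Some (a' + 2) \<Longrightarrow> 0 < a' \<Longrightarrow> read_before A' B' = read_before A B \<Longrightarrow>
      read_before A' C' = read_before A C \<Longrightarrow> read_before B' C' = read_before B C \<Longrightarrow>
      dual_move (a' + 1) T' = swap_entries (a' + p) (a' + q) T'"
proof -
  have ne: "A \<noteq> B" "A \<noteq> C" "B \<noteq> C" using assms by auto
  have *: "dual_move (a' + 1) T' = (if btw A B C then swap_entries (a' + 1) (a' + 2) T'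
     else if btw C B A then swap_entries (a' + 1) a' T' else T')"
    if "increasing T'" and T': "T' A' = Some a'" "T' B' = Some (a' + 1)" "T' C' = Some (a' + 2)"
      and "0 < a'" and rb: "read_before A' B' = read_before A B"
      "read_before A' C' = read_before A C" "read_before B' C' = read_before B C"
    for T' A' B' C' a'
  proof -
    have "A' \<noteq> B'" "A' \<noteq> C'" "B' \<noteq> C'" using T' by auto
    note btw = btw_cong[OF rb ne this]
    show ?thesis using dual_move_swap[OF that(1-5)] unfolding btw .
  qed
  have id: "swap_entries x x T' = T'" for x T'
    unfolding swap_entries_def by (rule ext) (simp add: option.map_ident_strong)
  consider "btw A B C" | "\<not> btw A B C" "btw C B A" | "\<not> btw A B C" "\<not> btw C B A" by blast
  thus ?thesis
  proof cases
    case 1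
    thus ?thesis using that[of 1 2] * by simp
  next
    case 2
    thus ?thesis using that[of 1 0] * by simp
  next
    case 3
    thus ?thesis using that[of 0 0] * id by simp
  qed
qed

section \<open>Moves applied copy by copy\<close>

fun block_moves :: "nat \<Rightarrow> nat \<Rightarrow> nat \<Rightarrow> tableau \<Rightarrow> tableau" where
  "block_moves i m 0 T = T"
| "block_moves i m (Suc n) T = dual_move (i + n * m) (block_moves i m n T)"

lemma dom_block_moves [simp]: "dom (block_moves i m n T) = dom T"
  by (induction n) simp_all

lemma skew_tab_block_moves: "skew_tab T \<Longrightarrow> skew_tab (block_moves i m n T)"
  by (induction n) (simp_all add: skew_tab_dual_move)

lemma Rect_block_moves:
  "skew_tab T \<Longrightarrow> Rect (block_moves i m n T) = block_moves i m n (Rect T)"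
  by (induction n) (simp_all add: Rect_dual_move skew_tab_block_moves)

lemma dual_move_above: "i + 1 < y \<Longrightarrow> T c = Some y \<Longrightarrow> dual_move i T c = Some y"
  unfolding dual_move_def swap_entries_def by auto

text \<open>The last of these moves involves entries up to \<open>i + 1 + (n - 1) * m\<close>, which
  is at most \<open>n * m\<close> since \<open>i < m\<close>.\<close>

lemma block_moves_above:
  assumes "i < m" "T c = Some y" "n * m < y" shows "block_moves i m n T c = Some y"
  using assms(3)
proof (induction n)
  case (Suc n)
  thus ?case using assms(1) by (auto intro!: dual_move_above)
qed (use assms in simp)

lemma block_moves_power_tab:
  assumes S: "row_standard S" and "0 < a"
    and A: "S A = Some a" and B: "S B = Some (a + 1)" and C: "S C = Some (a + 2)"
  shows "block_moves (a + 1) (card (dom S)) k (power_tab k S) = power_tab k (dual_move (a + 1) S)"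
proof -
  let ?m = "card (dom S)" and ?P = "power_tab k S"
  have st: "skew_tab S" and inc: "increasing S" using S by (auto simp: row_standard_def skew_tab_def)
  note range = row_standard_range[OF S]
  have am: "a + 2 \<le> ?m" using range[OF C] by simp
  from dual_move_uniform[OF inc A B C \<open>0 < a\<close>] obtain p q where pq: "p \<le> 2" "q \<le> 2"
    and move: "\<And>T' A' B' C' a'. increasing T' \<Longrightarrow> T' A' = Some a' \<Longrightarrow> T' B' = Some (a' + 1) \<Longrightarrow>
      T' C' = Some (a' + 2) \<Longrightarrow> 0 < a' \<Longrightarrow> read_before A' B' = read_before A B \<Longrightarrow>
      read_before A' C' = read_before A C \<Longrightarrow> read_before B' C' = read_before B C \<Longrightarrow>
      dual_move (a' + 1) T' = swap_entries (a' + p) (a' + q) T'" by blast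
  define \<sigma> where "\<sigma> v = (if v = a + p then a + q else if v = a + q then a + p else v)" for v
  have \<sigma>: "0 < \<sigma> v \<and> \<sigma> v \<le> ?m" if "0 < v" "v \<le> ?m" for v
    using that pq am \<open>0 < a\<close> by (auto simp: \<sigma>_def)
  \<comment> \<open>Cells of one row are shifted equally within a copy, so each copy is read in the
    order of \<open>S\<close> and undergoes the same swap.\<close>
  have rb: "read_before (lift S t c) (lift S t d) = read_before c d" for t c d
    by (auto simp: read_before_def lift_def)
  \<comment> \<open>After \<open>n\<close> moves exactly the copies below \<open>n\<close> are
    permuted; copy \<open>n\<close> is still untouched when its own move comes.\<close>
  have main: "block_moves (a + 1) ?m n ?P (lift S t c) = Some ((if t < n then \<sigma> v else v) + t * ?m)"
    if "n \<le> k" "t < k" "S c = Some v" for n t c v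
    using that
  proof (induction n arbitrary: t c v)
    case 0
    thus ?case using power_tab_lift[OF st] by simp
  next
    case (Suc n)
    let ?X = "block_moves (a + 1) ?m n ?P"
    have X: "?X (lift S n c) = Some (v + n * ?m)" if "S c = Some v" for c v
      using Suc.IH[of n c v] Suc.prems that by simp
    have "increasing ?X"
      using skew_tab_block_moves[OF skew_tab_power_tab[OF S]] by (simp add: skew_tab_def)
    hence "dual_move (a + n * ?m + 1) ?X = swap_entries (a + n * ?m + p) (a + n * ?m + q) ?X"
      using move[of ?X "lift S n A" "a + n * ?m" "lift S n B" "lift S n C"] X[OF A] X[OF B] X[OF C]
        \<open>0 < a\<close> rb by (simp add: algebra_simps)
    hence step: "block_moves (a + 1) ?m (Suc n) ?P = swap_entries (a + p + n * ?m) (a + q + n * ?m) ?X"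
      by (simp add: algebra_simps)
    define w where "w = (if t < n then \<sigma> v else v)"
    have w: "?X (lift S t c) = Some (w + t * ?m)" unfolding w_def using Suc by simp
    have wr: "0 < w" "w \<le> ?m" using \<sigma> range[OF Suc.prems(3)] by (auto simp: w_def)
    have eq: "w + t * ?m = a + r + n * ?m \<longleftrightarrow> t = n \<and> w = a + r" if "r \<le> 2" for r
      using block_unique[of w ?m "a + r" t n] wr am \<open>0 < a\<close> that by auto
    show ?case
    proof (cases "t = n")
      case True
      thus ?thesis using w eq[OF pq(1)] eq[OF pq(2)] unfolding step
        by (simp add: swap_entries_def w_def \<sigma>_def)
    next
      case False
      thus ?thesis using w eq[OF pq(1)] eq[OF pq(2)] unfolding step
        by (simp add: swap_entries_def w_def)
    qed
  qed
  let ?S' = "dual_move (a + 1) S"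
  have S': "?S' = swap_entries (a + p) (a + q) S" using move[OF inc A B C \<open>0 < a\<close>] by simp
  have st': "skew_tab ?S'" using skew_tab_dual_move[OF st] .
  have lift: "lift ?S' = lift S" by (rule lift_cong) simp
  show ?thesis
  proof (rule ext)
    fix x
    show "block_moves (a + 1) ?m k ?P x = power_tab k ?S' x"
    proof (cases "x \<in> dom ?P")
      case True
      then obtain t c v where *: "t < k" "S c = Some v" "x = lift S t c"
        by (auto elim: power_tab_SomeE[OF st])
      moreover have "?S' c = Some (\<sigma> v)" using * unfolding S' by (simp add: swap_entries_def \<sigma>_def)
      ultimately show ?thesis
        using main[of k t c v] power_tab_lift[OF st', of c "\<sigma> v" t k, unfolded lift] by simp
    next
      case False
      moreover have "dom (power_tab k ?S') = dom ?P"
        unfolding dom_power_tab[OF st] dom_power_tab[OF st'] lift by simp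
      moreover have "dom (block_moves (a + 1) ?m k ?P) = dom ?P" by simp
      ultimately show ?thesis by (metis domIff)
    qed
  qed
qed


section \<open>Stabilization\<close>

lemma swap_entries_swap_entries: "swap_entries a b (swap_entries a b T) = T"
proof
  show "swap_entries a b (swap_entries a b T) x = T x" for x
    by (cases "T x") (simp_all add: swap_entries_def)
qed

text \<open>The entry read in the middle stays where it is while the outer two are exchanged, so the
  second move takes the same branch.\<close>

lemma dual_move_dual_move:
  assumes T: "skew_tab T" shows "dual_move i (dual_move i T) = T"
proof (cases i T rule: dual_move_cases)
  case trivial
  thus ?thesis using dual_move_trivial by metis
next
  case (active a A B C)
  have inc: "increasing T" using T by (simp add: skew_tab_def)
  let ?D = "dual_move (a + 1) T"
  have incD: "increasing ?D" using skew_tab_dual_move[OF T] by (simp add: skew_tab_def)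
  note D = dual_move_swap[OF inc active(3-5,2)]
  consider "btw A B C" | "\<not> btw A B C" "btw C B A" | "\<not> btw A B C" "\<not> btw C B A" by blast
  thus ?thesis
  proof cases
    case 1
    hence D1: "?D = swap_entries (a + 1) (a + 2) T" using D by simp
    have v: "?D A = Some a" "?D C = Some (a + 1)" "?D B = Some (a + 2)"
      using active unfolding D1 swap_entries_Some by simp_all
    have "btw A C B" using 1 by (auto simp: btw_def)
    hence "dual_move (a + 1) ?D = swap_entries (a + 1) (a + 2) ?D"
      using dual_move_swap[OF incD v active(2)] by simp
    thus ?thesis unfolding active(1) D1 swap_entries_swap_entries .
  next
    case 2
    hence D1: "?D = swap_entries (a + 1) a T" using D by simp
    have v: "?D B = Some a" "?D A = Some (a + 1)" "?D C = Some (a + 2)"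
      using active unfolding D1 swap_entries_Some by simp_all
    have "btw C A B" "\<not> btw B A C" using 2(2) unfolding btw_def read_before_def by linarith+
    hence "dual_move (a + 1) ?D = swap_entries (a + 1) a ?D"
      using dual_move_swap[OF incD v active(2)] by simp
    thus ?thesis unfolding active(1) D1 swap_entries_swap_entries .
  next
    case 3
    thus ?thesis using D active(1) by simp
  qed
qed

lemma read_before_rows:
  assumes "increasing T" "T X = Some x" "T Y = Some y" "increasing T'" "T' X' = Some x" "T' Y' = Some y"
    and "x < y" "fst X' = fst X" "fst Y' = fst Y"
  shows "read_before X' Y' = read_before X Y"
proof -
  have "snd X < snd Y" if "increasing T" "T X = Some x" "T Y = Some y" "fst X = fst Y" for T X Y
  proof (rule ccontr)
    assume "\<not> snd X < snd Y"
    hence "y \<le> x" using increasing_le[OF that(1,3,2)] that(4) by (simp add: nw_def)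
    thus False using \<open>x < y\<close> by simp
  qed
  from this[OF assms(1-3)] this[OF assms(4-6)] show ?thesis
    using assms(8,9) unfolding read_before_def by auto
qed

lemma stabilizes_at_dual_move:
  assumes S: "row_standard S" and k: "1 \<le> k" and stable: "stabilizes_at S k"
  shows "stabilizes_at (dual_move i S) k"
proof (cases i S rule: dual_move_cases)
  case trivial
  thus ?thesis using stable dual_move_trivial by metis
next
  case (active a A B C)
  let ?m = "card (dom S)"
  \<comment> \<open>\<open>n\<close> is the number of the last copy: \<open>U'\<close> and
    \<open>W'\<close> have undergone all moves except the last one.\<close>
  obtain n where n: "k = Suc n" using k by (cases k) auto
  have st: "skew_tab S" using S by (simp add: row_standard_def)
  define U where "U = power_tab k S"
  define U' where "U' = block_moves i ?m n U"
  define W where "W = Rect U"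
  define W' where "W' = block_moves i ?m n W"
  have U: "skew_tab U" unfolding U_def by (rule skew_tab_power_tab[OF S])
  have W: "skew_tab W" "ran W = ran U" unfolding W_def using Rect_dual_move[OF U] by auto
  have inc: "increasing U" "increasing W" "increasing U'" "increasing W'"
    using U W skew_tab_block_moves by (auto simp: U'_def W'_def skew_tab_def)
  have am: "a + 2 \<le> ?m" using row_standard_range[OF S active(5)] by simp
  \<comment> \<open>Stability compares \<open>U\<close> and \<open>W\<close>; the first
    \<open>n\<close> moves do not touch these entries, so the comparison passes to \<open>U'\<close>
    and \<open>W'\<close>.\<close>
  have rows: "\<exists>c d. U c = Some y \<and> W d = Some y \<and> U' c = Some y \<and> W' d = Some y \<and> fst c = fst d"
    if y: "n * ?m < y" "y \<le> n * ?m + ?m" for y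
  proof -
    have "y - n * ?m \<in> ran S" using S y by (auto simp: row_standard_def)
    then obtain c0 where "S c0 = Some (y - n * ?m)" unfolding ran_def by blast
    hence c: "U (lift S n c0) = Some y" unfolding U_def using power_tab_lift[OF st, of c0 _ n k] n y by simp
    hence "y \<in> ran W" using W(2) by (auto intro: ranI)
    then obtain d where d: "W d = Some y" unfolding ran_def by blast
    have "row_of W y = row_of U y"
      using stable y n unfolding stabilizes_at_def U_def W_def by simp
    hence "fst d = fst (lift S n c0)"
      by (simp add: row_of_def cell_of_eq[OF inc(1) c] cell_of_eq[OF inc(2) d])
    thus ?thesis using c d block_moves_above[of i ?m _ _ y n] y am active(1) unfolding U'_def W'_def
      by (metis add_2_eq_Suc' Suc_eq_plus1 Suc_le_lessD)
  qed
  define b where "b = a + n * ?m"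
  have b: "n * ?m < b" "b + 2 \<le> n * ?m + ?m" using am active(2) by (auto simp: b_def)
  obtain A0 A1 where A: "U' A0 = Some b" "W' A1 = Some b" "fst A0 = fst A1"
    using rows[of b] b by auto
  obtain B0 B1 where B: "U' B0 = Some (b + 1)" "W' B1 = Some (b + 1)" "fst B0 = fst B1"
    using rows[of "b + 1"] b by auto
  obtain C0 C1 where C: "U' C0 = Some (b + 2)" "W' C1 = Some (b + 2)" "fst C0 = fst C1"
    using rows[of "b + 2"] b by auto
  have "0 < b" using b by simp
  from dual_move_uniform[OF inc(3) A(1) B(1) C(1) this] obtain p q where pq: "p \<le> 2" "q \<le> 2"
    and move: "\<And>T' A' B' C' a'. increasing T' \<Longrightarrow> T' A' = Some a' \<Longrightarrow> T' B' = Some (a' + 1) \<Longrightarrow>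
      T' C' = Some (a' + 2) \<Longrightarrow> 0 < a' \<Longrightarrow> read_before A' B' = read_before A0 B0 \<Longrightarrow>
      read_before A' C' = read_before A0 C0 \<Longrightarrow> read_before B' C' = read_before B0 C0 \<Longrightarrow>
      dual_move (a' + 1) T' = swap_entries (a' + p) (a' + q) T'" by blast
  have moveU: "dual_move (b + 1) U' = swap_entries (b + p) (b + q) U'"
    using move[OF inc(3) A(1) B(1) C(1) \<open>0 < b\<close>] by simp
  note rb = read_before_rows[OF inc(3) _ _ inc(4)]
  have moveW: "dual_move (b + 1) W' = swap_entries (b + p) (b + q) W'"
    by (rule move[OF inc(4) A(2) B(2) C(2) \<open>0 < b\<close>])
      (rule rb[OF A(1) B(1) A(2) B(2)] rb[OF A(1) C(1) A(2) C(2)] rb[OF B(1) C(1) B(2) C(2)];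
       simp add: A B C)+
  have ib: "i + n * ?m = b + 1" using active(1) by (simp add: b_def)
  have V: "power_tab k (dual_move i S) = dual_move (b + 1) U'"
    using block_moves_power_tab[OF S active(2-5), of k] ib
    by (simp add: active(1) U_def U'_def n)
  have "Rect (dual_move (b + 1) U') = dual_move (b + 1) W'"
    using Rect_block_moves[OF U, of i ?m "Suc n"] ib by (simp add: U'_def W'_def W_def)
  hence RV: "Rect (power_tab k (dual_move i S)) = dual_move (b + 1) W'" by (simp add: V)
  show ?thesis
    unfolding stabilizes_at_def RV unfolding V
  proof
    fix y assume "y \<in> {(k - 1) * card (dom (dual_move i S)) + 1..k * card (dom (dual_move i S))}"
    hence y: "n * ?m < y" "y \<le> n * ?m + ?m" using n by auto
    \<comment> \<open>The entry that the last move turns into \<open>y\<close>. As \<open>p\<close>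
      and \<open>q\<close> are at most 2, it also belongs to the last copy.\<close>
    define z where "z = (if y = b + p then b + q else if y = b + q then b + p else y)"
    have "n * ?m < z" "z \<le> n * ?m + ?m" using y b pq by (auto simp: z_def)
    then obtain c d where cd: "U' c = Some z" "W' d = Some z" "fst c = fst d"
      using rows by blast
    have "dual_move (b + 1) U' c = Some y" "dual_move (b + 1) W' d = Some y"
      unfolding moveU moveW swap_entries_Some using cd by (simp_all add: z_def)
    moreover have "increasing (dual_move (b + 1) U')" "increasing (dual_move (b + 1) W')"
      using skew_tab_dual_move skew_tab_block_moves U W(1) unfolding U'_def W'_def skew_tab_def by metis+
    ultimately show "row_of (dual_move (b + 1) W') y = row_of (dual_move (b + 1) U') y"
      using cd(3) by (simp add: row_of_def cell_of_eq)
  qed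
qed

lemma stab_dual_move:
  assumes "row_standard S" shows "stab (dual_move i S) = stab S"
proof -
  have "stabilizes_at (dual_move i S) k \<longleftrightarrow> stabilizes_at S k" if "1 \<le> k" for k
    using stabilizes_at_dual_move[OF assms that, of i]
      stabilizes_at_dual_move[OF row_standard_dual_move[OF assms] that, of i i]
      dual_move_dual_move[of S i] assms by (auto simp: row_standard_def)
  thus ?thesis unfolding stab_def by metis
qed

section \<open>Standard tableaux and the conclusion\<close>

lemma convex_cells_skew_shape:
  assumes "skew_shape C" shows "finite C" "convex_cells C"
proof -
  obtain lam mu where *: "young lam" "young mu" "C = lam - mu" using assms by (auto simp: skew_shape_def)
  thus "finite C" by (simp add: young_def)
  have down: "c \<in> D" if "young D" "d \<in> D" "nw c d" for c d D
  proof -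
    have "(fst d, snd d) \<in> D" using that by simp
    hence "(fst c, snd c) \<in> D" using that(1,3) unfolding young_def nw_def by blast
    thus ?thesis by simp
  qed
  show "convex_cells C"
    unfolding convex_cells_def *(3) using down[OF *(1)] down[OF *(2)] by blast
qed

text \<open>Comparable cells are joined along the row of \<open>c\<close> and then down the column
  of \<open>d\<close>, a path kept inside the shape by convexity. Weak inequalities suffice,
  strictness being a matter of injectivity.\<close>

lemma standard_skew_tab:
  assumes T: "standard T" shows "skew_tab T"
proof -
  have shape: "finite (dom T)" "convex_cells (dom T)"
    using convex_cells_skew_shape T by (auto simp: standard_def)
  have row: "the (T (i, j)) \<le> the (T (i, j + n))" if "(i, j) \<in> dom T" "(i, j + n) \<in> dom T" for i j n
    using that
  proof (induction n)
    case (Suc n)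
    have "(i, j + n) \<in> dom T"
      by (rule convex_cellsD[OF shape(2) Suc.prems]) (simp_all add: nw_def)
    thus ?case using Suc T unfolding standard_def by (metis add_Suc_right order_less_imp_le order_trans)
  qed simp
  have col: "the (T (i, j)) \<le> the (T (i + n, j))" if "(i, j) \<in> dom T" "(i + n, j) \<in> dom T" for i j n
    using that
  proof (induction n)
    case (Suc n)
    have "(i + n, j) \<in> dom T"
      by (rule convex_cellsD[OF shape(2) Suc.prems]) (simp_all add: nw_def)
    thus ?case using Suc T unfolding standard_def by (metis add_Suc_right add_Suc order_less_imp_le order_trans)
  qed simp
  have inj: "c = d" if "T c = Some x" "T d = Some x" for c d x
    using T that unfolding standard_def by (metis domI inj_onD)
  have "x < y" if "T c = Some x" "T d = Some y" "nw c d" "c \<noteq> d" for c d x y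
  proof -
    have dom: "c \<in> dom T" "d \<in> dom T" using that by auto
    have e: "(fst c, snd d) \<in> dom T"
      by (rule convex_cellsD[OF shape(2) dom]) (use that(3) in \<open>simp_all add: nw_def\<close>)
    have "the (T c) \<le> the (T (fst c, snd d))"
      using row[of "fst c" "snd c" "snd d - snd c"] e dom that(3) by (simp add: nw_def)
    also have "\<dots> \<le> the (T d)"
      using col[of "fst c" "snd d" "fst d - fst c"] e dom that(3) by (simp add: nw_def)
    finally have "x \<le> y" using that by simp
    thus ?thesis using inj that by (metis le_neq_implies_less)
  qed
  hence "increasing T" using shape inj unfolding increasing_def by blast
  thus ?thesis using shape by (simp add: skew_tab_def)
qed

theorem mainTheorem5:
  fixes S T :: tableau
  assumes "standard S" and "standard T" and "dom S = dom T"
    and "rows_weakly_decreasing S" and "rows_weakly_decreasing T"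
    and "dual_equiv S T"
  shows "stab S = stab T"
proof -
  have "row_standard S"
    using assms(1,4) standard_skew_tab by (simp add: row_standard_def standard_def)
  moreover have "(\<lambda>A B. \<exists>i. B = dual_move i A)\<^sup>*\<^sup>* S T"
    using assms(6) by (simp add: dual_equiv_def)
  ultimately have "row_standard S" "(\<lambda>A B. \<exists>i. B = dual_move i A)\<^sup>*\<^sup>* S T" .
  \<comment> \<open>\<open>row_standard\<close> is carried along because each single step of the
    chain requires it of the intermediate tableau.\<close>
  from this(2,1) have "row_standard T \<and> stab T = stab S"
    by induction (auto simp: row_standard_dual_move stab_dual_move)
  thus ?thesis by simp
qed

end
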